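(* Let $n\in\mathbb N$, $\alpha\in(0,1)$, and let $\psi_n:\mathbb R^{3n}\to\{0,1\}$ be any (measurable) test of $H_0^{\mathrm{ext}}:\Gamma_{\mathbf X\to\mathbf Y\mid\mathbf Z}<1$ against $H_1^{\mathrm{ext}}:\Gamma_{\mathbf X\to\mathbf Y\mid\mathbf Z}=1$. For every $P\in\mathcal A_0$: if $$\sup_{Q\in\mathcal P_0^{\mathrm{ext}}}Q(\psi_n=1)\le\alpha,\qquad\text{then}\qquad P(\psi_n=1)\le\alpha.$$
   Context: All processes $(\mathbf X,\mathbf Y,\mathbf Z)=((X_t,Y_t,Z_t),t\in\mathbb Z)$ here have real-valued components. $P(\psi_n=1)$ denotes the rejection probability of $\psi_n((X_1,Y_1,Z_1),\dots,(X_n,Y_n,Z_n))$ when the process has law $P$. $\Xi_0$ is the class of laws of strictly stationary processes $(\mathbf X,\mathbf Y,\mathbf Z)$ such that $Y_t=h_Y(X_{t-1},Y_{t-1},Z_{t-1},\varepsilon^Y_t)$ for all $t\in\mathbb Z$, for a measurable $h_Y$ and noise variables with $\varepsilon^Y_t$ independent of $\sigma(X_s,Y_s,Z_s:s<t)$ for all $t$, and such that all variables are absolutely continuous with respect to Lebesgue measure (finite-dimensional distributions of the process are absolutely continuous). With $\mathrm{past}(t)=(t,t-1,\dots)$, $\mathcal C_t^{-\mathbf X}=\sigma(\mathbf Y_{\mathrm{past}(t)},\mathbf Z_{\mathrm{past}(t)})$ and $F$ a cumulative distribution function with $F(x)<1$ for all $x$, $\Gamma_{\mathbf X\to\mathbf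 Y\mid\mathbf Z}=\lim_{v\to\infty}\mathbb E[F(Y_{t+1})\mid X_t>v,\mathcal C_t^{-\mathbf X}]$, where $\mathbb E[\,\cdot\mid X_t>v,\mathcal G]=\mathbb E[\,\cdot\,\mathbf 1\{X_t>v\}\mid\mathcal G]/P(X_t>v\mid\mathcal G)$. Throughout this statement it is implicitly assumed, for the processes under consideration, that $\Gamma_{\mathbf X\to\mathbf Y\mid\mathbf Z}$ exists and that all variables are supported on some neighborhood of infinity. $\mathcal P_0^{\mathrm{ext}}=\{P\in\Xi_0:\Gamma_{\mathbf X\to\mathbf Y\mid\mathbf Z}<1\text{ a.s.}\}$. $\mathcal A_0$ is the subclass of $\Xi_0$ of processes generated, for some mutually independent i.i.d. continuous innovation sequences $(\varepsilon^X_t)$, $(\varepsilon^Y_t)$, $(\varepsilon^Z_t)$ and some measurable $f:\mathbb R^3\to\mathbb R$, as $Z_t=\varepsilon^Z_t$, $X_t=\varepsilon^X_t$, $Y_t=f(X_{t-1},Z_{t-1},\varepsilon^Y_t)$, and for which $\mathbf X$ Granger-causes $\mathbf Y$ with respect to $\mathbf Z$, i.e. for some $t$, $Y_{t+1}$ is not conditionally independent of $\mathbf X_{\mathrm{past}(t)}$ given $\mathcal C_t^{-\mathbf X}$. *)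

theory Defs
  imports "HOL-Probability.Probability"
begin

type_synonym path = "int \<Rightarrow> real \<times> real \<times> real"

definition path_space :: "path measure" where
  "path_space = (\<Pi>\<^sub>M t\<in>UNIV. borel)"

definition X_coord :: "int \<Rightarrow> path \<Rightarrow> real" where "X_coord t w = fst (w t)"
definition Y_coord :: "int \<Rightarrow> path \<Rightarrow> real" where "Y_coord t w = fst (snd (w t))"
definition Z_coord :: "int \<Rightarrow> path \<Rightarrow> real" where "Z_coord t w = snd (snd (w t))"

definition process_law ::
  "'w measure \<Rightarrow> (int \<Rightarrow> 'w \<Rightarrow> real) \<Rightarrow> (int \<Rightarrow> 'w \<Rightarrow> real) \<Rightarrow> (int \<Rightarrow> 'w \<Rightarrow> real) \<Rightarrow> path measure" where
  "process_law M X Y Z = distr M path_space (\<lambda>\<omega> t. (X t \<omega>, Y t \<omega>, Z t \<omega>))"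

definition real_process :: "'w measure \<Rightarrow> (int \<Rightarrow> 'w \<Rightarrow> real) \<Rightarrow> bool" where
  "real_process M X \<longleftrightarrow> (\<forall>t. X t \<in> borel_measurable M)"

definition strictly_stationary :: "path measure \<Rightarrow> bool" where
  "strictly_stationary P \<longleftrightarrow> (\<forall>k. distr P path_space (\<lambda>w t. w (t + k)) = P)"

definition fdd_absolutely_continuous :: "path measure \<Rightarrow> bool" where
  "fdd_absolutely_continuous P \<longleftrightarrow>
     (\<forall>J. finite J \<longrightarrow>
        absolutely_continuous (\<Pi>\<^sub>M t\<in>J. lborel) (distr P (\<Pi>\<^sub>M t\<in>J. lborel) (\<lambda>w. restrict w J)))"

definition nonlinear_Y_recursion ::
  "'w measure \<Rightarrow> (int \<Rightarrow> 'w \<Rightarrow> real) \<Rightarrow> (int \<Rightarrow> 'w \<Rightarrow> real) \<Rightarrow> (int \<Rightarrow> 'w \<Rightarrow> real) \<Rightarrow>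
     (int \<Rightarrow> 'w \<Rightarrow> real) \<Rightarrow> (real \<times> real \<times> real \<times> real \<Rightarrow> real) \<Rightarrow> bool" where
  "nonlinear_Y_recursion M X Y Z eY h \<longleftrightarrow>
     h \<in> borel_measurable borel \<and>
     (\<forall>t. AE \<omega> in M. Y t \<omega> = h (X (t - 1) \<omega>, Y (t - 1) \<omega>, Z (t - 1) \<omega>, eY t \<omega>)) \<and>
     real_process M eY \<and>
     (\<forall>t. prob_space.indep_set M
        (sets (vimage_algebra (space M) (eY t) borel))
        (sets (vimage_algebra (space M) (\<lambda>\<omega>. \<lambda>s\<in>{..<t}. (X s \<omega>, Y s \<omega>, Z s \<omega>))
           (\<Pi>\<^sub>M s\<in>{..<t}. borel))))"

text \<open>
  Noise variables need not be functions of the process, so they live on an auxiliary probability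
  space. Fixing the type of its points loses nothing: any realisation, with up to three
  real-valued noise sequences, may be replaced by the joint law of process and noise, which is a
  measure on the type below.
\<close>

type_synonym sample = "path \<times> path"

definition Xi0 :: "path measure set" where
  "Xi0 = {P. strictly_stationary P \<and> fdd_absolutely_continuous P \<and>
     (\<exists>(M :: sample measure) X Y Z eY h.
        prob_space M \<and> real_process M X \<and> real_process M Y \<and> real_process M Z \<and>
        nonlinear_Y_recursion M X Y Z eY h \<and> P = process_law M X Y Z)}"

definition info_without_X :: "path measure \<Rightarrow> int \<Rightarrow> path measure" where
  "info_without_X P t =
     vimage_algebra (space P) (\<lambda>w. \<lambda>s\<in>{..t}. (Y_coord s w, Z_coord s w)) (\<Pi>\<^sub>M s\<in>{..t}. borel)"

definition exceedance_prob :: "path measure \<Rightarrow> int \<Rightarrow> real \<Rightarrow> path \<Rightarrow> real" where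
  "exceedance_prob P t v =
     real_cond_exp P (info_without_X P t) (indicator {w. X_coord t w > v})"

definition exceedance_mean :: "(real \<Rightarrow> real) \<Rightarrow> path measure \<Rightarrow> int \<Rightarrow> real \<Rightarrow> path \<Rightarrow> real" where
  "exceedance_mean F P t v w =
     real_cond_exp P (info_without_X P t)
       (\<lambda>w. F (Y_coord (t + 1) w) * indicator {w. X_coord t w > v} w) w
     / exceedance_prob P t v w"

text \<open>
  Conditional expectations are determined only up to a null set depending on the threshold $v$.
  The almost sure limit is therefore taken along rational thresholds, which makes it independent
  of the chosen versions. With regular conditional distributions, numerator and denominator are
  right-continuous in $v$, so the limits along rational and along real thresholds agree.
\<close>

definition Gamma :: "(real \<Rightarrow> real) \<Rightarrow> path measure \<Rightarrow> int \<Rightarrow> path \<Rightarrow> real" where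
  "Gamma F P t w = Lim at_top (\<lambda>q::rat. exceedance_mean F P t (of_rat q) w)"

text \<open>
  Positivity of the conditional exceedance probabilities is demanded explicitly: otherwise the
  convention $x / 0 = 0$ would assign the limit $0$ to an undefined quotient.
\<close>

definition Gamma_exists :: "(real \<Rightarrow> real) \<Rightarrow> path measure \<Rightarrow> bool" where
  "Gamma_exists F P \<longleftrightarrow>
     (\<forall>t. AE w in P. (\<forall>q::rat. exceedance_prob P t (of_rat q) w > 0) \<and>
        (\<exists>l. ((\<lambda>q::rat. exceedance_mean F P t (of_rat q) w) \<longlongrightarrow> l) at_top))"

definition law_support :: "real measure \<Rightarrow> real set" where
  "law_support D = {x. \<forall>U. open U \<and> x \<in> U \<longrightarrow> emeasure D U > 0}"

definition supported_near_infinity :: "path measure \<Rightarrow> bool" where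
  "supported_near_infinity P \<longleftrightarrow>
     (\<forall>t. \<forall>V\<in>{X_coord t, Y_coord t, Z_coord t}. \<exists>a. {a<..} \<subseteq> law_support (distr P borel V))"

definition extremally_regular :: "(real \<Rightarrow> real) \<Rightarrow> path measure \<Rightarrow> bool" where
  "extremally_regular F P \<longleftrightarrow> Gamma_exists F P \<and> supported_near_infinity P"

definition P0_ext :: "(real \<Rightarrow> real) \<Rightarrow> path measure set" where
  "P0_ext F = {P \<in> Xi0. extremally_regular F P \<and> (\<forall>t. AE w in P. Gamma F P t w < 1)}"

definition cond_indep_var ::
  "'w measure \<Rightarrow> 'w measure \<Rightarrow> 'a measure \<Rightarrow> ('w \<Rightarrow> 'a) \<Rightarrow> 'b measure \<Rightarrow> ('w \<Rightarrow> 'b) \<Rightarrow> bool" where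
  "cond_indep_var M G N1 U N2 V \<longleftrightarrow>
     (\<forall>A\<in>sets N1. \<forall>B\<in>sets N2. AE \<omega> in M.
        real_cond_exp M G (\<lambda>\<omega>. indicator A (U \<omega>) * indicator B (V \<omega>)) \<omega>
        = real_cond_exp M G (\<lambda>\<omega>. indicator A (U \<omega>)) \<omega>
          * real_cond_exp M G (\<lambda>\<omega>. indicator B (V \<omega>)) \<omega>)"

definition Granger_causes :: "path measure \<Rightarrow> bool" where
  "Granger_causes P \<longleftrightarrow>
     (\<exists>t. \<not> cond_indep_var P (info_without_X P t)
              borel (Y_coord (t + 1))
              (\<Pi>\<^sub>M s\<in>{..t}. borel) (\<lambda>w. \<lambda>s\<in>{..t}. X_coord s w))"

definition iid_continuous :: "'w measure \<Rightarrow> (int \<Rightarrow> 'w \<Rightarrow> real) \<Rightarrow> bool" where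
  "iid_continuous M e \<longleftrightarrow>
     prob_space.indep_vars M (\<lambda>_. borel) e UNIV \<and>
     (\<forall>t. distr M borel (e t) = distr M borel (e 0)) \<and>
     continuous_on UNIV (cdf (distr M borel (e 0)))"

definition sequences_mutually_indep ::
  "'w measure \<Rightarrow> (int \<Rightarrow> 'w \<Rightarrow> real) \<Rightarrow> (int \<Rightarrow> 'w \<Rightarrow> real) \<Rightarrow> (int \<Rightarrow> 'w \<Rightarrow> real) \<Rightarrow> bool" where
  "sequences_mutually_indep M e1 e2 e3 \<longleftrightarrow>
     prob_space.indep_vars M (\<lambda>_. \<Pi>\<^sub>M t\<in>UNIV. borel) (\<lambda>i \<omega> t. ([e1, e2, e3] ! i) t \<omega>) {0, 1, 2}"

definition A0 :: "path measure set" where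
  "A0 = {P \<in> Xi0. Granger_causes P \<and>
     (\<exists>(M :: sample measure) X Y Z eX eY eZ (f :: real \<times> real \<times> real \<Rightarrow> real).
        prob_space M \<and> real_process M X \<and> real_process M Y \<and> real_process M Z \<and>
        iid_continuous M eX \<and> iid_continuous M eY \<and> iid_continuous M eZ \<and>
        sequences_mutually_indep M eX eY eZ \<and>
        f \<in> borel_measurable borel \<and>
        (\<forall>t. AE \<omega> in M. Z t \<omega> = eZ t \<omega> \<and> X t \<omega> = eX t \<omega> \<and>
                         Y t \<omega> = f (X (t - 1) \<omega>, Z (t - 1) \<omega>, eY t \<omega>)) \<and>
        P = process_law M X Y Z)}"

definition rejection_prob ::
  "nat \<Rightarrow> ((nat \<Rightarrow> real \<times> real \<times> real) \<Rightarrow> nat) \<Rightarrow> path measure \<Rightarrow> ennreal" where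
  "rejection_prob n \<psi> P = emeasure P {w \<in> space P. \<psi> (\<lambda>i\<in>{1..n}. w (int i)) = 1}"

end

theory Submission
  imports Defs
begin

text \<open>
  Fix a large threshold $K$ and modify the process so that $Y_t$ ignores its regressors whenever
  $X_{t-1} > K$, taking instead an exponential value read off $\varepsilon^Y_t$ alone. For $v \ge K$
  the event $X_t > v$ forces $Y_{t+1}$ to be such a value, so the new $\Gamma$ is the constant
  $E\,F(\mathrm{Exp}(1)) < 1$ and the modified law lies in the extremal null. It differs from $P$ on
  $n$ observations only if some $X_{t-1}$ exceeds $K$, which has probability at most
  $n\,P(X_0 > K) \to 0$.
\<close>

section \<open>Lebesgue null sets under translation of one coordinate\<close>

text \<open>Both laws are images of the same noises, so they are coupled and can be compared path by
  path. The exponential law meets several demands at once: it has a density, that density is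
  positive on a half-line and so gives support near infinity, and, being a function of the
  \<open>Y\<close>-noise, it leaves the recursion driven by a noise independent of the past. The
  obstacle is absolute continuity. The \<open>Y\<close>-noise has merely a continuous cdf, possibly
  a singular one, and \<open>f\<close> is merely measurable, so no joint density can be computed
  from the construction. What is available is absolute continuity of \<open>P\<close> itself, as a
  member of \<open>Xi0\<close>. It is carried over to the modified law by null sets instead of
  densities, with one \<open>Y\<close>-coordinate replaced at a time; hence the facts on translated
  null sets.\<close>

lemma nn_integral_lborel_translate:
  fixes c :: "'b::euclidean_space"
  assumes [measurable]: "h \<in> borel_measurable borel"
  shows "(\<integral>\<^sup>+y. h (y + c) \<partial>lborel) = (\<integral>\<^sup>+y. h y \<partial>lborel)"
proof -
  have "(\<integral>\<^sup>+y. h y \<partial>lborel) = (\<integral>\<^sup>+y. h y \<partial>distr lborel borel ((+) c))"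
    by (simp add: lborel_distr_plus)
  also have "\<dots> = (\<integral>\<^sup>+y. h (y + c) \<partial>lborel)"
    by (subst nn_integral_distr) (auto simp: add.commute)
  finally show ?thesis by simp
qed

text \<open>Fubini isolates coordinate \<open>i\<close>, where Lebesgue measure is translation
  invariant, so the shifted indicator integrates to the measure of \<open>N\<close>.\<close>

lemma AE_PiM_lborel_translate_not_null:
  fixes c :: "'b::euclidean_space"
  assumes J: "finite J" "i \<in> J" and N: "N \<in> null_sets (\<Pi>\<^sub>M j\<in>J. lborel)"
  shows "AE w in (\<Pi>\<^sub>M j\<in>J. lborel). w(i := w i + c) \<notin> N"
proof -
  interpret product_sigma_finite "\<lambda>_::'a. lborel :: 'b measure" ..
  have J': "J = insert i (J - {i})" "i \<notin> J - {i}" "finite (J - {i})" using J by auto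
  have [measurable]: "N \<in> sets (\<Pi>\<^sub>M j\<in>J. lborel)" using N by auto
  have [measurable]: "N \<in> sets (\<Pi>\<^sub>M j\<in>insert i (J - {i}). lborel)"
    using N J'(1) by auto
  have upd: "(\<lambda>w. w(i := w i + c)) \<in> (\<Pi>\<^sub>M j\<in>J. lborel) \<rightarrow>\<^sub>M (\<Pi>\<^sub>M j\<in>J. lborel)"
    by (rule measurable_fun_upd[where J=J]) (use J in auto)
  then have upd': "(\<lambda>w. w(i := w i + c)) \<in> (\<Pi>\<^sub>M j\<in>insert i (J - {i}). lborel) \<rightarrow>\<^sub>M (\<Pi>\<^sub>M j\<in>insert i (J - {i}). lborel)"
    using J'(1) by simp
  have upd_ind: "(\<lambda>w. indicator N (w(i := w i + c)) :: ennreal) \<in> borel_measurable (\<Pi>\<^sub>M j\<in>insert i (J - {i}). lborel)"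
    by (rule measurable_compose[OF upd' borel_measurable_indicator]) fact
  have "(\<integral>\<^sup>+w. indicator N (w(i := w i + c)) \<partial>(\<Pi>\<^sub>M j\<in>J. lborel))
      = (\<integral>\<^sup>+w. \<integral>\<^sup>+y. indicator N (w(i := y + c)) \<partial>lborel \<partial>(\<Pi>\<^sub>M j\<in>J - {i}. lborel))"
    by (subst J'(1), subst product_nn_integral_insert[OF J'(3,2)])
       (use upd_ind in simp_all)
  also have "\<dots> = (\<integral>\<^sup>+w. \<integral>\<^sup>+y. indicator N (w(i := y)) \<partial>lborel \<partial>(\<Pi>\<^sub>M j\<in>J - {i}. lborel))"
  proof (rule nn_integral_cong)
    fix w assume w: "w \<in> space (\<Pi>\<^sub>M j\<in>J - {i}. (lborel :: 'b measure))"
    have m: "(\<lambda>y. w(i := y)) \<in> lborel \<rightarrow>\<^sub>M (\<Pi>\<^sub>M j\<in>insert i (J - {i}). lborel)"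
      using measurable_component_update[OF w J'(2)] by simp
    have "(\<lambda>y. indicator N (w(i := y)) :: ennreal) \<in> borel_measurable lborel"
      by (rule measurable_compose[OF m borel_measurable_indicator]) fact
    then have "(\<lambda>y. indicator N (w(i := y)) :: ennreal) \<in> borel_measurable borel" by simp
    from nn_integral_lborel_translate[OF this, of c]
    show "(\<integral>\<^sup>+y. indicator N (w(i := y + c)) \<partial>lborel) = (\<integral>\<^sup>+y. indicator N (w(i := y)) \<partial>lborel)" .
  qed
  also have "\<dots> = (\<integral>\<^sup>+w. indicator N w \<partial>(\<Pi>\<^sub>M j\<in>insert i (J - {i}). lborel))"
    by (rule product_nn_integral_insert[OF J'(3,2), symmetric]) measurable
  also have "\<dots> = 0" using N J'(1) by (simp add: null_setsD1)
  finally have "AE w in (\<Pi>\<^sub>M j\<in>J. lborel). (indicator N (w(i := w i + c)) :: ennreal) = 0"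
    by (subst nn_integral_0_iff_AE[symmetric]) (use upd in auto)
  then show ?thesis by eventually_elim (auto simp: indicator_def split: if_splits)
qed

text \<open>Each fixed shift is harmless by translation; Fubini then exchanges the two
  almost-everywhere quantifiers. With the base point fixed first, the shift can later be replaced by
  a random value that has a density.\<close>

lemma AE_PiM_lborel_translate2_not_null:
  fixes N :: "('i \<Rightarrow> real \<times> real \<times> real) set"
  assumes J: "finite J" "i \<in> J" and N: "N \<in> null_sets (\<Pi>\<^sub>M j\<in>J. lborel)"
  shows "AE w in (\<Pi>\<^sub>M j\<in>J. lborel). AE s in lborel. w(i := w i + (0, s, 0)) \<notin> N"
proof -
  interpret product_sigma_finite "\<lambda>_::'i. lborel :: (real \<times> real \<times> real) measure" ..
  interpret PJ: finite_product_sigma_finite "\<lambda>_::'i. lborel :: (real \<times> real \<times> real) measure" J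
    by standard fact
  interpret pair_sigma_finite "\<Pi>\<^sub>M j\<in>J. (lborel :: (real \<times> real \<times> real) measure)" "lborel :: real measure" ..
  have [measurable]: "N \<in> sets (\<Pi>\<^sub>M j\<in>J. lborel)" using N by auto
  have [measurable]: "(\<lambda>p. (fst p)(i := fst p i + (0, snd p, 0)))
      \<in> (\<Pi>\<^sub>M j\<in>J. lborel) \<Otimes>\<^sub>M (lborel::real measure) \<rightarrow>\<^sub>M (\<Pi>\<^sub>M j\<in>J. (lborel :: (real \<times> real \<times> real) measure))"
    by (rule measurable_fun_upd[where J=J]) (use J in auto)
  show ?thesis
  proof (subst AE_commute)
    show "AE s in lborel. AE w in (\<Pi>\<^sub>M j\<in>J. lborel). w(i := w i + (0, s, 0)) \<notin> N"
      using AE_PiM_lborel_translate_not_null[OF assms] by simp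
  qed measurable
qed

section \<open>Exponential variables from continuous noise\<close>

text \<open>A sublevel set of a continuous cdf is closed and downward closed, and
  \<open>u < 1\<close> bounds it above; it is thus the half-line up to its supremum, and flat
  stretches of the cdf do no harm.\<close>

lemma (in prob_space) prob_cdf_transform_le:
  assumes X[measurable]: "random_variable borel X"
    and cont: "continuous_on UNIV (cdf (distr M borel X))" and u: "0 \<le> u" "u < 1"
  shows "prob {\<omega>\<in>space M. cdf (distr M borel X) (X \<omega>) \<le> u} = u"
proof -
  let ?G = "cdf (distr M borel X)"
  interpret D: real_distribution "distr M borel X" by (rule real_distribution_distr) fact
  have iso: "isCont ?G x" for x using cont by (simp add: continuous_on_eq_continuous_at)
  define S where "S = {x. ?G x \<le> u}"
  have S_closed: "closed S"
    using closed_Collect_le[OF cont continuous_on_const] by (simp add: S_def)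
  have prob: "prob {\<omega>\<in>space M. ?G (X \<omega>) \<le> u} = measure (distr M borel X) S"
  proof -
    have [measurable]: "S \<in> sets borel"
      using S_closed by (rule borel_closed)
    have "X -` S \<inter> space M = {\<omega>\<in>space M. ?G (X \<omega>) \<le> u}" by (auto simp: S_def)
    then show ?thesis by (simp add: measure_distr)
  qed
  have "\<forall>\<^sub>F x in at_top. ?G x > u"
    using D.cdf_lim_at_top_prob u by (intro order_tendstoD) auto
  then obtain b where b: "?G b > u" by (auto simp: eventually_at_top_linorder)
  have bdd: "bdd_above S"
  proof (rule bdd_aboveI[of _ b])
    fix x assume "x \<in> S"
    then show "x \<le> b"
      using b D.cdf_nondecreasing[of b x] by (cases "x \<le> b") (auto simp: S_def)
  qed
  show ?thesis
  proof (cases "S = {}")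
    case True
    \<comment> \<open>A positive \<open>u\<close> would exceed the cdf far to the left, so the
      sublevel set is empty only at level 0.\<close>
    have "u = 0"
    proof (rule ccontr)
      assume "u \<noteq> 0"
      with u have "0 < u" by simp
      then have "\<forall>\<^sub>F x in at_bot. ?G x < u"
        using D.cdf_lim_at_bot by (intro order_tendstoD) auto
      then obtain c where "?G c < u" by (auto simp: eventually_at_bot_linorder)
      then have "c \<in> S" by (simp add: S_def)
      then show False using True by simp
    qed
    with True prob show ?thesis by simp
  next
    case False
    have mem: "Sup S \<in> S" using False bdd S_closed by (simp add: closed_contains_Sup)
    have S: "S = {..Sup S}"
    proof safe
      fix x assume "x \<in> S" then show "x \<le> Sup S" using bdd by (rule cSup_upper)
    next
      fix x assume "x \<le> Sup S" then show "x \<in> S"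
        using mem D.cdf_nondecreasing[of x "Sup S"] by (auto simp: S_def)
    qed
    \<comment> \<open>If the value were below \<open>u\<close>, the intermediate value theorem would
      give a point further right with value exactly \<open>u\<close>, hence in \<open>S\<close> and
      beyond its supremum.\<close>
    have "?G (Sup S) = u"
    proof (rule ccontr)
      assume "?G (Sup S) \<noteq> u"
      with mem have lt: "?G (Sup S) < u" by (auto simp: S_def)
      have le: "Sup S \<le> b" using b mem D.cdf_nondecreasing[of b "Sup S"] by (cases "Sup S \<le> b") (auto simp: S_def)
      obtain y where y: "Sup S \<le> y" "?G y = u"
        using IVT[of ?G "Sup S" u b] lt b le iso by auto
      then have "y \<in> S" by (auto simp: S_def)
      then have "y \<le> Sup S" using bdd by (rule cSup_upper)
      with y lt show False by simp
    qed
    then have "measure (distr M borel X) {..Sup S} = u" by (simp add: cdf_def)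
    then show ?thesis unfolding prob by (subst S)
  qed
qed

lemma (in prob_space) exponential_distributed_cdf_transform:
  assumes X[measurable]: "random_variable borel X"
    and cont: "continuous_on UNIV (cdf (distr M borel X))"
  shows "distributed M lborel (\<lambda>\<omega>. - ln (1 - cdf (distr M borel X) (X \<omega>))) (exponential_density 1)"
proof -
  define G where "G = cdf (distr M borel X)"
  have [measurable]: "G \<in> borel_measurable borel"
    unfolding G_def using cont by (rule borel_measurable_continuous_onI)
  note le = prob_cdf_transform_le[OF X cont, folded G_def]
  \<comment> \<open>Where the cdf reaches 1, the argument of \<open>ln\<close> is 0 and the
    logarithm no longer inverts \<open>exp\<close>. This is a null event because the transform stays
    below every \<open>u < 1\<close> with probability \<open>u\<close>.\<close>
  have AE1: "AE \<omega> in M. G (X \<omega>) < 1"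
  proof -
    have "prob {\<omega>\<in>space M. G (X \<omega>) < 1} \<ge> u" if "u < 1" for u
    proof (cases "u \<ge> 0")
      case True
      have "u = prob {\<omega>\<in>space M. G (X \<omega>) \<le> u}"
        using le[OF True that] by simp
      also have "\<dots> \<le> prob {\<omega>\<in>space M. G (X \<omega>) < 1}"
        using that by (intro finite_measure_mono) auto
      finally show ?thesis .
    next
      case False
      then show ?thesis using measure_nonneg[of M "{\<omega>\<in>space M. G (X \<omega>) < 1}"] by linarith
    qed
    then have "prob {\<omega>\<in>space M. G (X \<omega>) < 1} \<ge> 1" by (rule dense_le)
    then have "prob {\<omega>\<in>space M. G (X \<omega>) < 1} = 1" by (intro antisym prob_le_1)
    then show ?thesis by (subst (asm) prob_Collect_eq_1) measurable
  qed
  show ?thesis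
    unfolding G_def[symmetric]
  proof (rule exponential_distributed_iff[THEN iffD2, OF zero_less_one], intro conjI allI impI)
    show "random_variable borel (\<lambda>\<omega>. - ln (1 - G (X \<omega>)))" by measurable
  next
    fix a :: real assume a: "0 \<le> a"
    have "prob {\<omega>\<in>space M. - ln (1 - G (X \<omega>)) \<le> a} = prob {\<omega>\<in>space M. G (X \<omega>) \<le> 1 - exp (- a)}"
    proof (rule measure_eq_AE)
      show "AE x in M. (x \<in> {\<omega>\<in>space M. - ln (1 - G (X \<omega>)) \<le> a}) = (x \<in> {\<omega>\<in>space M. G (X \<omega>) \<le> 1 - exp (- a)})"
        using AE1
      proof eventually_elim
        case (elim x)
        have "- ln (1 - G (X x)) \<le> a \<longleftrightarrow> exp (- a) \<le> 1 - G (X x)"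
          using elim ln_ge_iff[of "1 - G (X x)" "- a"] by auto
        then show ?case by auto
      qed
    qed auto
    also have "\<dots> = 1 - exp (- a)" using a by (intro le) auto
    finally show "\<P>(\<omega> in M. - ln (1 - G (X \<omega>)) \<le> a) = 1 - exp (- a * 1)" by simp
  qed
qed

text \<open>The density is positive on the positive half-line, so probability 0 would make the
  nonempty open set \<open>U \<inter> {0<..}\<close> negligible. It supplies the support of the
  switched \<open>Y\<close> near infinity.\<close>

lemma (in prob_space) distributed_exponential_open_pos:
  assumes X: "distributed M lborel X (exponential_density l)" and l: "0 < l"
    and U: "open U" "x \<in> U" "0 < x"
  shows "prob {\<omega>\<in>space M. X \<omega> \<in> U} > 0"
proof (rule ccontr)
  assume "\<not> ?thesis"
  then have "prob {\<omega>\<in>space M. X \<omega> \<in> U} = 0" using measure_nonneg[of M] by (simp add: antisym not_less)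
  then have "emeasure M (X -` U \<inter> space M) = 0"
    by (simp add: emeasure_eq_measure vimage_def Int_def conj_commute)
  moreover have [measurable]: "U \<in> sets lborel" using U by simp
  ultimately have "(\<integral>\<^sup>+y. ennreal (exponential_density l y) * indicator U y \<partial>lborel) = 0"
    using distributed_emeasure[OF X, of U] by simp
  then have "AE y in lborel. ennreal (exponential_density l y) * indicator U y = 0"
    by (subst (asm) nn_integral_0_iff_AE) measurable
  then have "AE y in lborel. y \<notin> U \<inter> {0<..}"
    by eventually_elim (use l in \<open>auto simp: exponential_density_def indicator_def ennreal_eq_0_iff mult_le_0_iff split: if_splits\<close>)
  then have "U \<inter> {0<..} \<in> null_sets lborel"
    using U by (subst (asm) AE_iff_null_sets[symmetric]) auto
  then have "negligible (U \<inter> {0<..})"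
    by (simp add: negligible_iff_null_sets null_sets_completionI)
  moreover have "open (U \<inter> {0<..})" "U \<inter> {0<..} \<noteq> {}" using U by auto
  ultimately show False using open_not_negligible by blast
qed

section \<open>Independence\<close>

text \<open>Independence is assumed in two layers, between the noise sequences and within each one.
  Merged into a single family over pairs of sequence and time, it can be split into arbitrary
  disjoint blocks of noises.\<close>

lemma (in prob_space) indep_vars_nested:
  assumes outer: "indep_vars (\<lambda>i. \<Pi>\<^sub>M t\<in>T. N i t) (\<lambda>i \<omega>. \<lambda>t\<in>T. e i t \<omega>) I"
    and inner: "\<And>i. i \<in> I \<Longrightarrow> indep_vars (N i) (e i) T"
  shows "indep_vars (\<lambda>(i, t). N i t) (\<lambda>(i, t). e i t) (I \<times> T)"
  unfolding indep_vars_def2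
proof safe
  fix i t assume "i \<in> I" "t \<in> T"
  then show "random_variable (N i t) (e i t)"
    using inner[of i] by (auto simp: indep_vars_def2)
next
  have rv: "e i t \<in> M \<rightarrow>\<^sub>M N i t" if "i \<in> I" "t \<in> T" for i t
    using inner[of i] that by (auto simp: indep_vars_def2)
  show "indep_sets (\<lambda>i. {(case i of (i, t) \<Rightarrow> e i t) -` A \<inter> space M |A. A \<in> sets (case i of (i, t) \<Rightarrow> N i t)}) (I \<times> T)"
  proof (rule indep_setsI)
    fix p assume "p \<in> I \<times> T"
    then show "{(case p of (i, t) \<Rightarrow> e i t) -` A \<inter> space M |A. A \<in> sets (case p of (i, t) \<Rightarrow> N i t)} \<subseteq> events"
      using rv by (auto intro!: measurable_sets)
  next
    fix A J assume J: "J \<noteq> {}" "J \<subseteq> I \<times> T" "finite J"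
      and A: "\<forall>j\<in>J. A j \<in> {(case j of (i, t) \<Rightarrow> e i t) -` A \<inter> space M |A. A \<in> sets (case j of (i, t) \<Rightarrow> N i t)}"
    have "\<forall>j\<in>J. \<exists>B. B \<in> sets (N (fst j) (snd j)) \<and> A j = e (fst j) (snd j) -` B \<inter> space M"
      using A by (auto simp: case_prod_unfold)
    then obtain B where B: "\<And>j. j \<in> J \<Longrightarrow> B j \<in> sets (N (fst j) (snd j))"
      "\<And>j. j \<in> J \<Longrightarrow> A j = e (fst j) (snd j) -` B j \<inter> space M" by metis
    define L where "L = fst ` J"
    define S where "S i = {t. (i, t) \<in> J}" for i
    have L: "finite L" "L \<noteq> {}" "L \<subseteq> I" using J by (auto simp: L_def)
    have S: "finite (S i)" "S i \<subseteq> T" for i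
      using J finite_subset[of "S i" "snd ` J"] by (force simp: S_def)+
    have SL: "S i \<noteq> {}" if "i \<in> L" for i using that by (auto simp: S_def L_def)
    have J_eq: "J = Sigma L S" by (force simp: L_def S_def)
    \<comment> \<open>A cylinder in the space of the \<open>i\<close>-th sequence gathering all
      events of \<open>J\<close> that concern this sequence. Outer independence factorises over the
      cylinders, inner independence inside each of them.\<close>
    define C where "C i = {w \<in> space (\<Pi>\<^sub>M t\<in>T. N i t). \<forall>t\<in>S i. w t \<in> B (i, t)}" for i
    have C: "C i \<in> sets (\<Pi>\<^sub>M t\<in>T. N i t)" if "i \<in> L" for i
      unfolding C_def
    proof (rule sets.sets_Collect_finite_All'[OF _ S(1) SL[OF that]])
      fix t assume t: "t \<in> S i"
      then have "B (i, t) \<in> sets (N i t)" "t \<in> T" using B[of "(i, t)"] S(2)[of i] by (auto simp: S_def)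
      then show "{w \<in> space (\<Pi>\<^sub>M t\<in>T. N i t). w t \<in> B (i, t)} \<in> sets (\<Pi>\<^sub>M t\<in>T. N i t)"
        by measurable
    qed
    have pre: "(\<lambda>\<omega>. \<lambda>t\<in>T. e i t \<omega>) -` C i \<inter> space M = (\<Inter>t\<in>S i. A (i, t))" if "i \<in> L" for i
    proof -
      have "(\<lambda>t\<in>T. e i t \<omega>) \<in> space (\<Pi>\<^sub>M t\<in>T. N i t)" if "\<omega> \<in> space M" for \<omega>
        using rv[THEN measurable_space, OF _ _ that] L(3) \<open>i \<in> L\<close> by (auto simp: space_PiM)
      then show ?thesis
        using S[of i] SL[OF that] B(2) by (auto simp: C_def S_def)
    qed
    have "prob (\<Inter>j\<in>J. A j) = prob (\<Inter>i\<in>L. \<Inter>t\<in>S i. A (i, t))"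
      by (rule arg_cong[where f=prob]) (force simp: J_eq)
    also have "\<dots> = prob (\<Inter>i\<in>L. (\<lambda>\<omega>. \<lambda>t\<in>T. e i t \<omega>) -` C i \<inter> space M)"
      using pre by simp
    also have "\<dots> = (\<Prod>i\<in>L. prob ((\<lambda>\<omega>. \<lambda>t\<in>T. e i t \<omega>) -` C i \<inter> space M))"
      using L C by (rule_tac indep_varsD[OF outer]) auto
    also have "\<dots> = (\<Prod>i\<in>L. \<Prod>t\<in>S i. prob (A (i, t)))"
    proof (intro prod.cong refl)
      fix i assume i: "i \<in> L"
      have "prob (\<Inter>t\<in>S i. e i t -` B (i, t) \<inter> space M) = (\<Prod>t\<in>S i. prob (e i t -` B (i, t) \<inter> space M))"
      proof (rule indep_varsD[OF inner])
        show "i \<in> I" using i L by auto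
        show "B (i, t) \<in> sets (N i t)" if "t \<in> S i" for t
          using B(1)[of "(i, t)"] that by (simp add: S_def)
      qed (use S SL[OF i] in auto)
      moreover have "A (i, t) = e i t -` B (i, t) \<inter> space M" if "t \<in> S i" for t
        using B(2)[of "(i, t)"] that by (auto simp: S_def)
      ultimately show "prob ((\<lambda>\<omega>. \<lambda>t\<in>T. e i t \<omega>) -` C i \<inter> space M) = (\<Prod>t\<in>S i. prob (A (i, t)))"
        using pre[OF i] by simp
    qed
    also have "\<dots> = (\<Prod>j\<in>Sigma L S. prob (A j))"
      using L(1) S(1) by (subst prod.Sigma) (auto simp: case_prod_unfold)
    also have "\<dots> = (\<Prod>j\<in>J. prob (A j))" using J_eq by simp
    finally show "prob (\<Inter>j\<in>J. A j) = (\<Prod>j\<in>J. prob (A j))" .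
  qed
qed

text \<open>The library's \<open>indep_var\<close> forces both variables to take values in the same type.\<close>

definition indep_pair :: "'w measure \<Rightarrow> 'a measure \<Rightarrow> ('w \<Rightarrow> 'a) \<Rightarrow> 'b measure \<Rightarrow> ('w \<Rightarrow> 'b) \<Rightarrow> bool" where
  "indep_pair M S U T V \<longleftrightarrow> U \<in> M \<rightarrow>\<^sub>M S \<and> V \<in> M \<rightarrow>\<^sub>M T \<and>
     distr M (S \<Otimes>\<^sub>M T) (\<lambda>\<omega>. (U \<omega>, V \<omega>)) = distr M S U \<Otimes>\<^sub>M distr M T V"

lemma (in prob_space) indep_pair_iff_indep_var:
  "indep_pair M S U T V \<longleftrightarrow> indep_var S U T V"
  by (auto simp: indep_pair_def indep_var_distribution_eq)

lemma (in prob_space) indep_pair_compose: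
  assumes ind: "indep_pair M S U T V"
    and [measurable]: "\<phi> \<in> S \<rightarrow>\<^sub>M S'" "\<theta> \<in> T \<rightarrow>\<^sub>M T'"
  shows "indep_pair M S' (\<lambda>\<omega>. \<phi> (U \<omega>)) T' (\<lambda>\<omega>. \<theta> (V \<omega>))"
proof -
  have [measurable]: "U \<in> M \<rightarrow>\<^sub>M S" "V \<in> M \<rightarrow>\<^sub>M T" using ind by (auto simp: indep_pair_def)
  interpret T': prob_space "distr (distr M T V) T' \<theta>"
    by (intro prob_space.prob_space_distr prob_space_distr) measurable
  have "distr M (S' \<Otimes>\<^sub>M T') (\<lambda>\<omega>. (\<phi> (U \<omega>), \<theta> (V \<omega>)))
      = distr (distr M (S \<Otimes>\<^sub>M T) (\<lambda>\<omega>. (U \<omega>, V \<omega>))) (S' \<Otimes>\<^sub>M T') (\<lambda>(x, y). (\<phi> x, \<theta> y))"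
    by (subst distr_distr) (auto simp: comp_def)
  also have "\<dots> = distr (distr M S U) S' \<phi> \<Otimes>\<^sub>M distr (distr M T V) T' \<theta>"
    using ind by (subst pair_measure_distr) (auto simp: indep_pair_def T'.sigma_finite_measure_axioms)
  finally show ?thesis
    by (simp add: indep_pair_def distr_distr comp_def)
qed

lemma (in prob_space) indep_pair_distr:
  assumes [measurable]: "\<phi> \<in> M \<rightarrow>\<^sub>M N" "U \<in> N \<rightarrow>\<^sub>M S" "V \<in> N \<rightarrow>\<^sub>M T"
    and ind: "indep_pair M S (\<lambda>\<omega>. U (\<phi> \<omega>)) T (\<lambda>\<omega>. V (\<phi> \<omega>))"
  shows "indep_pair (distr M N \<phi>) S U T V"
  using ind unfolding indep_pair_def by (simp add: distr_distr comp_def)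

lemma (in prob_space) indep_pair_prob:
  assumes ind: "indep_pair M S U T V" and [measurable]: "A \<in> sets S" "B \<in> sets T"
  shows "prob {\<omega>\<in>space M. U \<omega> \<in> A \<and> V \<omega> \<in> B}
      = prob {\<omega>\<in>space M. U \<omega> \<in> A} * prob {\<omega>\<in>space M. V \<omega> \<in> B}"
proof -
  have [measurable]: "U \<in> M \<rightarrow>\<^sub>M S" "V \<in> M \<rightarrow>\<^sub>M T" using ind by (auto simp: indep_pair_def)
  interpret V: prob_space "distr M T V" by (rule prob_space_distr) measurable
  have "emeasure (distr M (S \<Otimes>\<^sub>M T) (\<lambda>\<omega>. (U \<omega>, V \<omega>))) (A \<times> B) = emeasure (distr M S U) A * emeasure (distr M T V) B"
    using ind by (simp add: indep_pair_def V.emeasure_pair_measure_Times)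
  then show ?thesis
    by (simp add: emeasure_distr emeasure_eq_measure vimage_def Int_def conj_commute ennreal_mult[symmetric])
qed

text \<open>Every member of these algebras is itself a preimage, so the product formula for
  preimages suffices and no generator argument arises. This is the form of independence demanded by
  \<open>nonlinear_Y_recursion\<close>.\<close>

lemma (in prob_space) indep_set_vimage_algebra:
  assumes ind: "indep_pair M S U T V"
  shows "indep_set (sets (vimage_algebra (space M) U S)) (sets (vimage_algebra (space M) V T))"
proof -
  have UV: "U \<in> M \<rightarrow>\<^sub>M S" "V \<in> M \<rightarrow>\<^sub>M T" using ind by (auto simp: indep_pair_def)
  then have sp: "U \<in> space M \<rightarrow> space S" "V \<in> space M \<rightarrow> space T" by (auto dest: measurable_space)
  show ?thesis
    unfolding sets_vimage_algebra2[OF sp(1)] sets_vimage_algebra2[OF sp(2)]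
  proof (rule indep_setI)
    fix a b assume "a \<in> {U -` A \<inter> space M |A. A \<in> sets S}" "b \<in> {V -` A \<inter> space M |A. A \<in> sets T}"
    then obtain A B where AB: "A \<in> sets S" "B \<in> sets T" and ab: "a = U -` A \<inter> space M" "b = V -` B \<inter> space M"
      by auto
    have "a \<inter> b = {\<omega>\<in>space M. U \<omega> \<in> A \<and> V \<omega> \<in> B}" "a = {\<omega>\<in>space M. U \<omega> \<in> A}" "b = {\<omega>\<in>space M. V \<omega> \<in> B}"
      unfolding ab by auto
    then show "prob (a \<inter> b) = prob a * prob b" using indep_pair_prob[OF ind AB] by simp
  qed (use UV in \<open>auto intro: measurable_sets\<close>)
qed

text \<open>The indicator of a conditioning event is a function of \<open>T\<close>, hence
  independent of \<open>h\<close>, and the integral of \<open>h\<close> over the event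
  factorises.\<close>

lemma (in prob_space) real_cond_exp_indep_vimage:
  fixes h :: "'a \<Rightarrow> real"
  assumes ind: "indep_pair M borel h N T" and int: "integrable M h"
  shows "AE \<omega> in M. real_cond_exp M (vimage_algebra (space M) T N) h \<omega> = expectation h"
proof -
  let ?F = "vimage_algebra (space M) T N"
  have T[measurable]: "T \<in> M \<rightarrow>\<^sub>M N" and [measurable]: "h \<in> borel_measurable M"
    using ind by (auto simp: indep_pair_def)
  have Tsp: "T \<in> space M \<rightarrow> space N" using measurable_space[OF T] by blast
  interpret finite_measure_subalgebra M ?F
  proof
    show "subalgebra M ?F"
      unfolding subalgebra_def sets_vimage_algebra2[OF Tsp] using T by (auto intro: measurable_sets)
  qed
  show ?thesis
  proof (rule real_cond_exp_charact)
    fix A assume "A \<in> sets ?F"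
    then obtain B where B[measurable]: "B \<in> sets N" and A: "A = T -` B \<inter> space M"
      by (auto simp: sets_vimage_algebra2[OF Tsp])
    have ind': "indep_var borel h borel (\<lambda>\<omega>. indicator B (T \<omega>) :: real)"
      using indep_pair_compose[OF ind, of "\<lambda>x. x" borel "\<lambda>x. indicator B x :: real" borel]
      by (simp add: indep_pair_iff_indep_var)
    have "integrable M (\<lambda>\<omega>. indicator B (T \<omega>) :: real)"
      by (rule integrable_const_bound[where B=1]) auto
    from indep_var_lebesgue_integral[OF ind' int this]
    have eq: "(\<integral>\<omega>. h \<omega> * indicator B (T \<omega>) \<partial>M) = expectation h * (\<integral>\<omega>. indicator B (T \<omega>) \<partial>M)" .
    show "(\<integral>\<omega>\<in>A. h \<omega> \<partial>M) = (\<integral>\<omega>\<in>A. expectation h \<partial>M)"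
    proof -
      have "(\<integral>\<omega>\<in>A. k \<omega> \<partial>M) = (\<integral>\<omega>. k \<omega> * indicator B (T \<omega>) \<partial>M)" for k :: "'a \<Rightarrow> real"
        unfolding set_lebesgue_integral_def A
        by (intro Bochner_Integration.integral_cong) (auto simp: indicator_def)
      then show ?thesis using eq by simp
    qed
  qed (use int in auto)
qed

lemma measurable_component_compose:
  assumes "j \<in> B" and "h \<in> N \<rightarrow>\<^sub>M L"
  shows "(\<lambda>u. h (u j)) \<in> (\<Pi>\<^sub>M j\<in>B. N) \<rightarrow>\<^sub>M L"
  by (rule measurable_compose[OF measurable_component_singleton[OF assms(1), of "\<lambda>_. N"] assms(2)])

lemma borel_measurable_fst_snd [measurable]:
  "fst \<in> borel_measurable (borel :: ('a::second_countable_topology \<times> 'b::second_countable_topology) measure)"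
  "snd \<in> borel_measurable (borel :: ('a::second_countable_topology \<times> 'b::second_countable_topology) measure)"
  by (auto intro!: borel_measurable_continuous_onI continuous_intros)

section \<open>The switched process\<close>

abbreviation noise_index :: "(nat \<times> int) set" where
  "noise_index \<equiv> {0, 1, 2} \<times> UNIV"

text \<open>Only noises are fixed here; the processes are rebuilt from them, so that original and
  modified paths share one probability space. Of \<open>g\<close>, only measurability and the
  exponential law of its value at each \<open>Y\<close>-noise matter.\<close>

locale innovation_model = prob_space M for M :: "'w measure" +
  fixes e :: "nat \<times> int \<Rightarrow> 'w \<Rightarrow> real" and f :: "real \<times> real \<times> real \<Rightarrow> real" and g :: "real \<Rightarrow> real"
  assumes indep: "indep_vars (\<lambda>_. borel) e noise_index"
    and ident: "i \<in> {0, 1, 2} \<Longrightarrow> distr M borel (e (i, t)) = distr M borel (e (i, 0))"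
    and f_measurable [measurable]: "f \<in> borel_measurable borel"
    and g_measurable [measurable]: "g \<in> borel_measurable borel"
    and g_distributed: "distributed M lborel (\<lambda>\<omega>. g (e (1, t) \<omega>)) (exponential_density 1)"
begin

text \<open>
  Indices 0, 1, 2 stand for the noises of $X$, $Y$, $Z$. The switch acts only at the times in \<open>S\<close>:
  the empty set gives the original process and \<open>UNIV\<close> the modified one, while finite sets serve the
  induction for absolute continuity.
\<close>

definition hybrid :: "real \<Rightarrow> int set \<Rightarrow> (nat \<times> int \<Rightarrow> real) \<Rightarrow> path" where
  "hybrid K S u t = (u (0, t),
     (if t \<in> S \<and> K < u (0, t - 1) then g (u (1, t)) else f (u (0, t - 1), u (2, t - 1), u (1, t))),
     u (2, t))"

definition law :: "real \<Rightarrow> int set \<Rightarrow> path measure" where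
  "law K S = distr M path_space (\<lambda>\<omega>. hybrid K S (\<lambda>j. e j \<omega>))"

declare One_nat_def [simp del]

lemma e_measurable [measurable]:
  "e (0, t) \<in> borel_measurable M" "e (1, t) \<in> borel_measurable M"
  "e (2, t) \<in> borel_measurable M"
  using indep by (auto simp: indep_vars_def2)

text \<open>A component reads at most five noises. Measurability over any block \<open>B\<close>
  containing them is what allows independence of disjoint blocks to be applied to pieces of the
  path.\<close>

lemma hybrid_component_measurable:
  assumes "{(0, t), (1, t), (2, t), (0, t - 1), (2, t - 1)} \<subseteq> B"
  shows "(\<lambda>u. hybrid K S u t) \<in> (\<Pi>\<^sub>M j\<in>B. borel) \<rightarrow>\<^sub>M borel"
proof -
  have [measurable]: "(\<lambda>u. u (0, t)) \<in> borel_measurable (\<Pi>\<^sub>M j\<in>B. borel :: real measure)"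
    "(\<lambda>u. u (1, t)) \<in> borel_measurable (\<Pi>\<^sub>M j\<in>B. borel :: real measure)"
    "(\<lambda>u. u (2, t)) \<in> borel_measurable (\<Pi>\<^sub>M j\<in>B. borel :: real measure)"
    "(\<lambda>u. u (0, t - 1)) \<in> borel_measurable (\<Pi>\<^sub>M j\<in>B. borel :: real measure)"
    "(\<lambda>u. u (2, t - 1)) \<in> borel_measurable (\<Pi>\<^sub>M j\<in>B. borel :: real measure)"
    using assms by (auto intro!: measurable_component_singleton)
  show ?thesis unfolding hybrid_def by measurable
qed

lemma hybrid_noise_component_measurable [measurable]:
  "(\<lambda>\<omega>. hybrid K S (\<lambda>j. e j \<omega>) t) \<in> M \<rightarrow>\<^sub>M borel"
  unfolding hybrid_def by measurable

lemma hybrid_noise_measurable [measurable]: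
  "(\<lambda>\<omega>. hybrid K S (\<lambda>j. e j \<omega>)) \<in> M \<rightarrow>\<^sub>M path_space"
  unfolding path_space_def
  using measurable_abs_UNIV[of "\<lambda>t \<omega>. hybrid K S (\<lambda>j. e j \<omega>) t" M "\<lambda>_. borel"] by simp

lemma path_component_measurable [measurable]: "(\<lambda>w. w t) \<in> path_space \<rightarrow>\<^sub>M borel"
  unfolding path_space_def by measurable

lemma coord_measurable [measurable]:
  "X_coord t \<in> borel_measurable path_space" "Y_coord t \<in> borel_measurable path_space"
  "Z_coord t \<in> borel_measurable path_space"
  unfolding X_coord_def Y_coord_def Z_coord_def by measurable

lemma prob_space_law: "prob_space (law K S)"
  unfolding law_def by (rule prob_space_distr) measurable

lemma sets_law [simp, measurable_cong]: "sets (law K S) = sets path_space"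
  by (simp add: law_def)

lemma process_law_hybrid:
  "process_law M (\<lambda>t. e (0, t)) (\<lambda>t \<omega>. fst (snd (hybrid K S (\<lambda>j. e j \<omega>) t))) (\<lambda>t. e (2, t)) = law K S"
proof -
  have "(\<lambda>\<omega> t. (e (0, t) \<omega>, fst (snd (hybrid K S (\<lambda>j. e j \<omega>) t)), e (2, t) \<omega>))
      = (\<lambda>\<omega>. hybrid K S (\<lambda>j. e j \<omega>))"
    by (simp add: fun_eq_iff hybrid_def)
  then show ?thesis by (simp add: process_law_def law_def)
qed

lemma indep_pair_noise:
  assumes "A \<inter> B = {}" "A \<subseteq> noise_index" "B \<subseteq> noise_index"
    and "\<phi> \<in> (\<Pi>\<^sub>M j\<in>A. borel) \<rightarrow>\<^sub>M N1" "\<theta> \<in> (\<Pi>\<^sub>M j\<in>B. borel) \<rightarrow>\<^sub>M N2"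
  shows "indep_pair M N1 (\<lambda>\<omega>. \<phi> (\<lambda>j\<in>A. e j \<omega>)) N2 (\<lambda>\<omega>. \<theta> (\<lambda>j\<in>B. e j \<omega>))"
  by (rule indep_pair_compose[OF indep_var_restrict[OF indep assms(1-3), folded indep_pair_iff_indep_var]
      assms(4,5)])

section \<open>Stationarity and the recursion of the modified process\<close>

text \<open>The joint law of the noises is a product measure. A time shift is an injective
  reindexing of its factors, and it leaves the product unchanged because each sequence is
  identically distributed in time.\<close>

lemma strictly_stationary_law: "strictly_stationary (law K UNIV)"
  unfolding strictly_stationary_def
proof
  fix k :: int
  define sh where "sh = (\<lambda>(i::nat, t). (i, t + k))"
  let ?I = noise_index
  let ?P = "\<Pi>\<^sub>M j\<in>?I. (borel :: real measure)"
  define E where "E \<omega> = (\<lambda>j\<in>?I. e j \<omega>)" for \<omega>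
  have E[measurable]: "E \<in> M \<rightarrow>\<^sub>M ?P"
    unfolding E_def by (rule measurable_restrict) auto
  have rv: "random_variable borel (e j)" if "j \<in> ?I" for j
    using that by auto
  have E_law: "distr M ?P E = (\<Pi>\<^sub>M j\<in>?I. distr M borel (e j))"
    using indep rv unfolding E_def by (subst (asm) indep_vars_iff_distr_eq_PiM') auto
  have sh: "inj_on sh ?I" "sh \<in> ?I \<rightarrow> ?I" by (auto simp: sh_def inj_on_def)
  have S[measurable]: "(\<lambda>u. \<lambda>j\<in>?I. u (sh j)) \<in> ?P \<rightarrow>\<^sub>M ?P"
    using sh by (intro measurable_restrict measurable_component_singleton) auto
  have "distr M ?P (\<lambda>\<omega>. \<lambda>j\<in>?I. e (sh j) \<omega>) = distr (distr M ?P E) ?P (\<lambda>u. \<lambda>j\<in>?I. u (sh j))"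
    unfolding distr_distr[OF S E]
  proof (intro distr_cong refl)
    show "(\<lambda>j\<in>?I. e (sh j) \<omega>) = ((\<lambda>u. \<lambda>j\<in>?I. u (sh j)) \<circ> E) \<omega>" for \<omega>
      unfolding comp_def using sh by (intro restrict_ext) (auto simp: E_def)
  qed
  also have "\<dots> = distr (\<Pi>\<^sub>M j\<in>?I. distr M borel (e j)) (\<Pi>\<^sub>M j\<in>?I. distr M borel (e (sh j))) (\<lambda>u. \<lambda>j\<in>?I. u (sh j))"
    unfolding E_law by (intro distr_cong refl sets_PiM_cong) auto
  also have "\<dots> = (\<Pi>\<^sub>M j\<in>?I. distr M borel (e (sh j)))"
    using rv by (intro distr_PiM_reindex sh prob_space_distr) auto
  also have "\<dots> = (\<Pi>\<^sub>M j\<in>?I. distr M borel (e j))"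
  proof (intro PiM_cong refl)
    fix j assume "j \<in> ?I"
    then show "distr M borel (e (sh j)) = distr M borel (e j)"
      using ident[of "fst j" "snd j"] ident[of "fst j" "snd j + k"] by (cases j) (auto simp: sh_def)
  qed
  finally have eq: "distr M ?P (\<lambda>\<omega>. \<lambda>j\<in>?I. e (sh j) \<omega>) = distr M ?P E"
    using E_law by simp
  have H[measurable]: "hybrid K UNIV \<in> ?P \<rightarrow>\<^sub>M path_space"
    unfolding path_space_def
    using measurable_abs_UNIV[of "\<lambda>t u. hybrid K UNIV u t" ?P "\<lambda>_. borel"] hybrid_component_measurable[of _ ?I]
    by simp
  have [measurable]: "(\<lambda>\<omega>. \<lambda>j\<in>?I. e (sh j) \<omega>) \<in> M \<rightarrow>\<^sub>M ?P"
    using sh rv by (intro measurable_restrict) blast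
  have [measurable]: "(\<lambda>w t. w (t + k)) \<in> path_space \<rightarrow>\<^sub>M path_space"
    unfolding path_space_def by (rule measurable_abs_UNIV) measurable
  \<comment> \<open>Shifting the path amounts to building it from shifted noises: the set of
    switching times is all of \<open>UNIV\<close>, hence itself invariant.\<close>
  have "distr (law K UNIV) path_space (\<lambda>w t. w (t + k))
      = distr M path_space (\<lambda>\<omega>. hybrid K UNIV (\<lambda>j\<in>?I. e (sh j) \<omega>))"
    unfolding law_def
    by (subst distr_distr) (auto simp: comp_def hybrid_def sh_def fun_eq_iff algebra_simps intro!: distr_cong)
  also have "\<dots> = distr (distr M ?P E) path_space (hybrid K UNIV)"
    unfolding eq[symmetric] by (subst distr_distr[OF H]) (measurable, simp add: comp_def)
  also have "\<dots> = law K UNIV"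
    unfolding law_def by (subst distr_distr[OF H E]) (auto simp: comp_def E_def hybrid_def fun_eq_iff intro!: distr_cong)
  finally show "distr (law K UNIV) path_space (\<lambda>w t. w (t + k)) = law K UNIV" .
qed

lemma nonlinear_Y_recursion_hybrid:
  "nonlinear_Y_recursion M (\<lambda>t. e (0, t)) (\<lambda>t \<omega>. fst (snd (hybrid K UNIV (\<lambda>j. e j \<omega>) t))) (\<lambda>t. e (2, t))
     (\<lambda>t. e (1, t)) (\<lambda>(x, y, z, \<epsilon>). if K < x then g \<epsilon> else f (x, z, \<epsilon>))"
  (is "nonlinear_Y_recursion M ?X ?Y ?Z ?eY ?h")
  unfolding nonlinear_Y_recursion_def
proof (intro conjI allI)
  show "?h \<in> borel_measurable borel"
    unfolding borel_prod[symmetric] case_prod_unfold by measurable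
  show "real_process M ?eY" by (simp add: real_process_def)
  fix t
  show "AE \<omega> in M. ?Y t \<omega> = ?h (?X (t - 1) \<omega>, ?Y (t - 1) \<omega>, ?Z (t - 1) \<omega>, ?eY t \<omega>)"
    by (simp add: hybrid_def)
  \<comment> \<open>The path strictly before \<open>t\<close> reads only noises at times below
    \<open>t\<close>, a block that misses the current \<open>Y\<close>-noise
    \<open>(1, t)\<close>.\<close>
  define B where "B = {0, 1, 2::nat} \<times> {..<t}"
  have "(\<lambda>u. u (1, t)) \<in> (\<Pi>\<^sub>M j\<in>{(1, t)}. borel) \<rightarrow>\<^sub>M (borel :: real measure)"
    by (rule measurable_component_singleton) simp
  moreover have "(\<lambda>u. \<lambda>s\<in>{..<t}. hybrid K UNIV u s) \<in> (\<Pi>\<^sub>M j\<in>B. borel) \<rightarrow>\<^sub>M (\<Pi>\<^sub>M s\<in>{..<t}. borel)"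
    by (intro measurable_restrict hybrid_component_measurable) (auto simp: B_def)
  ultimately have "indep_pair M borel (\<lambda>\<omega>. (\<lambda>j\<in>{(1, t)}. e j \<omega>) (1, t))
      (\<Pi>\<^sub>M s\<in>{..<t}. borel) (\<lambda>\<omega>. \<lambda>s\<in>{..<t}. hybrid K UNIV (\<lambda>j\<in>B. e j \<omega>) s)"
    by (rule indep_pair_noise[rotated 3]) (auto simp: B_def)
  also have "(\<lambda>\<omega>. (\<lambda>j\<in>{(1, t)}. e j \<omega>) (1, t)) = ?eY t" by simp
  also have "(\<lambda>\<omega>. \<lambda>s\<in>{..<t}. hybrid K UNIV (\<lambda>j\<in>B. e j \<omega>) s)
      = (\<lambda>\<omega>. \<lambda>s\<in>{..<t}. (?X s \<omega>, ?Y s \<omega>, ?Z s \<omega>))"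
    by (intro ext restrict_ext) (auto simp: B_def hybrid_def)
  finally show "indep_set
        (sets (vimage_algebra (space M) (?eY t) borel))
        (sets (vimage_algebra (space M) (\<lambda>\<omega>. \<lambda>s\<in>{..<t}. (?X s \<omega>, ?Y s \<omega>, ?Z s \<omega>)) (\<Pi>\<^sub>M s\<in>{..<t}. borel)))"
    by (rule indep_set_vimage_algebra)
qed

section \<open>Absolute continuity of the finite-dimensional distributions\<close>

lemma finite_dim_measurable [measurable]:
  "(\<lambda>\<omega>. restrict (hybrid K S (\<lambda>j. e j \<omega>)) J) \<in> M \<rightarrow>\<^sub>M (\<Pi>\<^sub>M t\<in>J. lborel)"
  by (intro measurable_restrict) simp

lemma fdd_absolutely_continuous_law_iff:
  "fdd_absolutely_continuous (law K S) \<longleftrightarrow> (\<forall>J. finite J \<longrightarrow>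
     absolutely_continuous (\<Pi>\<^sub>M t\<in>J. lborel)
       (distr M (\<Pi>\<^sub>M t\<in>J. lborel) (\<lambda>\<omega>. restrict (hybrid K S (\<lambda>j. e j \<omega>)) J)))"
proof -
  have "(\<lambda>w. restrict w J) \<in> path_space \<rightarrow>\<^sub>M (\<Pi>\<^sub>M t\<in>J. lborel)" for J
    by (intro measurable_restrict) simp
  then show ?thesis
    unfolding fdd_absolutely_continuous_def law_def by (simp add: distr_distr comp_def)
qed

lemma AE_g_noise:
  assumes "AE s in lborel. Q s"
  shows "AE s in distr M lborel (\<lambda>\<omega>. g (e (1, t) \<omega>)). Q s"
proof (rule absolutely_continuous_AE[OF _ _ assms])
  show "absolutely_continuous lborel (distr M lborel (\<lambda>\<omega>. g (e (1, t) \<omega>)))"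
    unfolding distributed_distr_eq_density[OF g_distributed]
    using distributed_borel_measurable[OF g_distributed] by (rule absolutely_continuousI_density)
qed simp

text \<open>
  By translation invariance, almost every value may be written into the $Y$-coordinate at time $r$
  without hitting a given null set. The switched value of $Y_r$ is independent of all other
  coordinates and has a density, so it almost surely avoids the exceptional values.
\<close>

lemma absolutely_continuous_hybrid_insert:
  assumes J: "finite J"
    and ac: "absolutely_continuous (\<Pi>\<^sub>M t\<in>J. lborel)
       (distr M (\<Pi>\<^sub>M t\<in>J. lborel) (\<lambda>\<omega>. restrict (hybrid K S (\<lambda>j. e j \<omega>)) J))"
  shows "absolutely_continuous (\<Pi>\<^sub>M t\<in>J. lborel)
       (distr M (\<Pi>\<^sub>M t\<in>J. lborel) (\<lambda>\<omega>. restrict (hybrid K (insert r S) (\<lambda>j. e j \<omega>)) J))"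
proof (cases "r \<in> J")
  case False
  then have "restrict (hybrid K (insert r S) u) J = restrict (hybrid K S u) J" for u
    by (auto simp: hybrid_def restrict_def fun_eq_iff)
  with ac show ?thesis by simp
next
  case r: True
  let ?PJ = "\<Pi>\<^sub>M t\<in>J. (lborel :: (real \<times> real \<times> real) measure)"
  define V where "V \<omega> = restrict (hybrid K S (\<lambda>j. e j \<omega>)) J" for \<omega>
  define G where "G \<omega> = g (e (1, r) \<omega>)" for \<omega>
  \<comment> \<open>\<open>\<rho>\<close> blanks the \<open>Y\<close>-coordinate at time
    \<open>r\<close>, the only place where the noise \<open>(1, r)\<close> enters. Thus
    \<open>R\<close> is independent of \<open>G\<close>, and \<open>put\<close> writes a value into
    the blank slot.\<close>
  define \<rho> where "\<rho> u = (\<lambda>t\<in>J. if t = r then (u (0, r), 0, u (2, r)) else hybrid K S u t)" for u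
  define R where "R \<omega> = \<rho> (\<lambda>j. e j \<omega>)" for \<omega>
  define put where "put p = (fst p)(r := fst p r + (0, snd p, 0))" for p :: "path \<times> real"
  define B where "B = noise_index - {(1, r)}"
  have V[measurable]: "V \<in> M \<rightarrow>\<^sub>M ?PJ" unfolding V_def by measurable
  have G[measurable]: "G \<in> M \<rightarrow>\<^sub>M lborel" unfolding G_def by measurable
  have \<rho>: "\<rho> \<in> (\<Pi>\<^sub>M j\<in>B. borel) \<rightarrow>\<^sub>M ?PJ"
    unfolding \<rho>_def
  proof (rule measurable_restrict)
    fix t assume "t \<in> J"
    have "(\<lambda>u. (u (0, r), 0, u (2, r))) \<in> (\<Pi>\<^sub>M j\<in>B. borel) \<rightarrow>\<^sub>M (borel :: (real \<times> real \<times> real) measure)"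
    proof -
      have [measurable]: "(\<lambda>u. u (0, r)) \<in> borel_measurable (\<Pi>\<^sub>M j\<in>B. borel :: real measure)"
        "(\<lambda>u. u (2, r)) \<in> borel_measurable (\<Pi>\<^sub>M j\<in>B. borel :: real measure)"
        by (auto intro!: measurable_component_singleton simp: B_def)
      show ?thesis by measurable
    qed
    moreover have "(\<lambda>u. hybrid K S u t) \<in> (\<Pi>\<^sub>M j\<in>B. borel) \<rightarrow>\<^sub>M borel" if "t \<noteq> r"
      by (rule hybrid_component_measurable) (use that in \<open>auto simp: B_def\<close>)
    ultimately show "(\<lambda>u. if t = r then (u (0, r), 0, u (2, r)) else hybrid K S u t)
        \<in> (\<Pi>\<^sub>M j\<in>B. borel) \<rightarrow>\<^sub>M lborel"
      by (cases "t = r") auto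
  qed
  have R_restrict: "R \<omega> = \<rho> (\<lambda>j\<in>B. e j \<omega>)" for \<omega>
    unfolding R_def \<rho>_def by (intro restrict_ext) (auto simp: B_def hybrid_def)
  have "(\<lambda>u. g (u (1, r))) \<in> (\<Pi>\<^sub>M j\<in>{(1, r)}. borel) \<rightarrow>\<^sub>M lborel"
    by (rule measurable_component_compose) simp_all
  from indep_pair_noise[OF _ _ _ \<rho> this] have ind: "indep_pair M ?PJ R lborel G"
    by (simp add: B_def R_restrict[abs_def, unfolded B_def] G_def[abs_def])
  then have R[measurable]: "R \<in> M \<rightarrow>\<^sub>M ?PJ" by (simp add: indep_pair_def)
  have put[measurable]: "put \<in> ?PJ \<Otimes>\<^sub>M lborel \<rightarrow>\<^sub>M ?PJ"
    unfolding put_def[abs_def] by (rule measurable_fun_upd[where J=J]) (use r in auto)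
  interpret G: prob_space "distr M lborel G" by (rule prob_space_distr) measurable
  show ?thesis
    unfolding absolutely_continuous_def
  proof safe
    fix N assume N: "N \<in> null_sets ?PJ"
    then have [measurable]: "N \<in> sets ?PJ" by auto
    have V_N: "AE \<omega> in M. V \<omega> \<notin> N"
    proof (rule AE_distrD[OF V])
      show "AE w in distr M ?PJ V. w \<notin> N"
        using AE_not_in[OF N] by (rule absolutely_continuous_AE[rotated 2]) (use ac in \<open>simp_all add: V_def[abs_def]\<close>)
    qed
    have "AE w in distr M ?PJ V. AE s in lborel. w(r := w r + (0, s, 0)) \<notin> N"
      using AE_PiM_lborel_translate2_not_null[OF J r N]
      by (rule absolutely_continuous_AE[rotated 2]) (use ac in \<open>simp_all add: V_def[abs_def]\<close>)
    then have "AE \<omega> in M. AE s in lborel. (V \<omega>)(r := V \<omega> r + (0, s, 0)) \<notin> N"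
      by (rule AE_distrD[OF V])
    then have "AE \<omega> in M. AE s in distr M lborel G. put (R \<omega>, s) \<notin> N"
    proof eventually_elim
      case (elim \<omega>)
      \<comment> \<open>\<open>y\<close> is the unswitched value of \<open>Y\<close> at time
        \<open>r\<close>. Shifting by \<open>s - y\<close> writes the value \<open>s\<close> itself,
        and translation invariance turns "almost every shift" into "almost every written
        value".\<close>
      define y where "y = fst (snd (V \<omega> r))"
      have "AE s in distr lborel borel ((+) (- y)). (V \<omega>)(r := V \<omega> r + (0, s, 0)) \<notin> N"
        using elim unfolding lborel_distr_plus .
      then have "AE s in lborel. (V \<omega>)(r := V \<omega> r + (0, - y + s, 0)) \<notin> N"
        by (rule AE_distrD[rotated]) simp
      moreover have "(V \<omega>)(r := V \<omega> r + (0, - y + s, 0)) = put (R \<omega>, s)" for s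
        using r by (auto simp: put_def R_def \<rho>_def V_def y_def hybrid_def fun_eq_iff)
      ultimately show ?case unfolding G_def[abs_def] by (intro AE_g_noise) simp
    qed
    with AE_space have "AE \<omega> in M. (\<integral>\<^sup>+s. indicator N (put (R \<omega>, s)) \<partial>distr M lborel G) = 0"
    proof eventually_elim
      case (elim \<omega>)
      then have "R \<omega> \<in> space ?PJ" by (intro measurable_space[OF R])
      then have [measurable]: "(\<lambda>s. put (R \<omega>, s)) \<in> lborel \<rightarrow>\<^sub>M ?PJ"
        by (rule measurable_compose[OF measurable_Pair1' put])
      have "(\<lambda>s. indicator N (put (R \<omega>, s)) :: ennreal) \<in> borel_measurable (distr M lborel G)"
        by measurable
      from nn_integral_0_iff_AE[OF this] elim show ?case by (auto simp: indicator_def elim!: eventually_mono)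
    qed
    \<comment> \<open>Independence of \<open>R\<close> and \<open>G\<close> identifies this iterated
      integral with the probability that the path carrying the value \<open>G\<close> at time
      \<open>r\<close> lies in \<open>N\<close>.\<close>
    then have "(\<integral>\<^sup>+\<omega>. \<integral>\<^sup>+s. indicator N (put (R \<omega>, s)) \<partial>distr M lborel G \<partial>M) = (\<integral>\<^sup>+\<omega>. 0 \<partial>M)"
      by (rule nn_integral_cong_AE)
    also have "(\<integral>\<^sup>+\<omega>. \<integral>\<^sup>+s. indicator N (put (R \<omega>, s)) \<partial>distr M lborel G \<partial>M)
        = (\<integral>\<^sup>+w. \<integral>\<^sup>+s. indicator N (put (w, s)) \<partial>distr M lborel G \<partial>distr M ?PJ R)"
      by (subst nn_integral_distr[OF R]) auto
    also have "\<dots> = (\<integral>\<^sup>+p. indicator N (put p) \<partial>(distr M ?PJ R \<Otimes>\<^sub>M distr M lborel G))"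
      by (subst G.nn_integral_fst) auto
    also have "\<dots> = (\<integral>\<^sup>+\<omega>. indicator N (put (R \<omega>, G \<omega>)) \<partial>M)"
    proof -
      have "distr M ?PJ R \<Otimes>\<^sub>M distr M lborel G = distr M (?PJ \<Otimes>\<^sub>M lborel) (\<lambda>\<omega>. (R \<omega>, G \<omega>))"
        using ind by (simp add: indep_pair_def)
      then show ?thesis by (simp add: nn_integral_distr)
    qed
    finally have "(\<integral>\<^sup>+\<omega>. indicator N (put (R \<omega>, G \<omega>)) \<partial>M) = 0" by simp
    then have "AE \<omega> in M. (indicator N (put (R \<omega>, G \<omega>)) :: ennreal) = 0"
      by (subst (asm) nn_integral_0_iff_AE) auto
    with V_N have "AE \<omega> in M. restrict (hybrid K (insert r S) (\<lambda>j. e j \<omega>)) J \<notin> N"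
    proof eventually_elim
      case (elim \<omega>)
      \<comment> \<open>The switched path is pointwise one of two paths that both avoid
        \<open>N\<close> almost surely, so the switching event never has to be conditioned on,
        although it may depend on \<open>R\<close>.\<close>
      have "restrict (hybrid K (insert r S) (\<lambda>j. e j \<omega>)) J
          = (if K < e (0, r - 1) \<omega> then put (R \<omega>, G \<omega>) else V \<omega>)"
        using r by (auto simp: put_def R_def \<rho>_def V_def G_def hybrid_def fun_eq_iff)
      with elim show ?case by (auto simp: indicator_def split: if_splits)
    qed
    then show "N \<in> null_sets (distr M ?PJ (\<lambda>\<omega>. restrict (hybrid K (insert r S) (\<lambda>j. e j \<omega>)) J))"
      by (subst null_sets_distr_iff) (auto simp: AE_iff_null_sets vimage_def Int_def conj_commute)
  qed
qed

text \<open>The distribution on a finite \<open>J\<close> sees only the switches at times in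
  \<open>J\<close>, so finitely many insertions lead from the original law to the modified
  one.\<close>

lemma fdd_absolutely_continuous_law:
  assumes "fdd_absolutely_continuous (law K {})"
  shows "fdd_absolutely_continuous (law K UNIV)"
  unfolding fdd_absolutely_continuous_law_iff
proof safe
  fix J :: "int set" assume J: "finite J"
  have "absolutely_continuous (\<Pi>\<^sub>M t\<in>J. lborel)
       (distr M (\<Pi>\<^sub>M t\<in>J. lborel) (\<lambda>\<omega>. restrict (hybrid K S (\<lambda>j. e j \<omega>)) J))" if "finite S" for S
    using that
  proof induction
    case empty
    from assms J show ?case unfolding fdd_absolutely_continuous_law_iff by blast
  next
    case (insert r S)
    then show ?case using J by (intro absolutely_continuous_hybrid_insert)
  qed
  from this[OF J] show "absolutely_continuous (\<Pi>\<^sub>M t\<in>J. lborel)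
       (distr M (\<Pi>\<^sub>M t\<in>J. lborel) (\<lambda>\<omega>. restrict (hybrid K UNIV (\<lambda>j. e j \<omega>)) J))"
    by (simp add: hybrid_def restrict_def cong: if_cong)
qed

section \<open>Comparison of the rejection probabilities\<close>

lemma rejection_prob_law_le:
  assumes \<psi>: "\<psi> \<in> (\<Pi>\<^sub>M i\<in>{1..n}. borel) \<rightarrow>\<^sub>M count_space {0, 1}"
  shows "rejection_prob n \<psi> (law K {})
    \<le> rejection_prob n \<psi> (law K UNIV) + ennreal (real n * prob {\<omega>\<in>space M. K < e (0, 0) \<omega>})"
proof -
  let ?r = "\<lambda>S \<omega>. \<psi> (\<lambda>i\<in>{1..n}. hybrid K S (\<lambda>j. e j \<omega>) (int i))"
  have T: "(\<lambda>w. \<lambda>i\<in>{1..n}. w (int i)) \<in> path_space \<rightarrow>\<^sub>M (\<Pi>\<^sub>M i\<in>{1..n}. borel)"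
    by (intro measurable_restrict) measurable
  have space_path_space: "space path_space = UNIV" by (simp add: path_space_def space_PiM)
  have \<psi>T: "{w. \<psi> (\<lambda>i\<in>{1..n}. w (int i)) = 1} \<in> sets path_space"
    using measurable_sets[OF measurable_compose[OF T \<psi>], of "{1}"]
    by (simp add: vimage_def path_space_def space_PiM)
  have rej: "rejection_prob n \<psi> (law K S) = emeasure M {\<omega>\<in>space M. ?r S \<omega> = 1}" for S
    unfolding rejection_prob_def law_def
    using \<psi>T by (subst emeasure_distr) (auto simp: space_path_space intro!: arg_cong[where f="emeasure M"])
  have meas: "{\<omega>\<in>space M. ?r S \<omega> = 1} \<in> events" for S
  proof -
    have "(\<lambda>\<omega>. \<lambda>i\<in>{1..n}. hybrid K S (\<lambda>j. e j \<omega>) (int i)) \<in> M \<rightarrow>\<^sub>M (\<Pi>\<^sub>M i\<in>{1..n}. borel)"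
      by (intro measurable_restrict) measurable
    from measurable_sets[OF measurable_compose[OF this \<psi>], of "{1}"] show ?thesis
      by (simp add: vimage_def Int_def conj_commute)
  qed
  \<comment> \<open>The switch at time \<open>i\<close> is triggered by \<open>X\<close> one step
    earlier, so observations 1 to \<open>n\<close> are affected only through times 0 to
    \<open>n - 1\<close>.\<close>
  define D where "D i = {\<omega>\<in>space M. K < e (0, int i - 1) \<omega>}" for i :: nat
  have D: "D i \<in> events" for i unfolding D_def by measurable
  have D_prob: "prob (D i) = prob {\<omega>\<in>space M. K < e (0, 0) \<omega>}" for i
  proof -
    have "measure (distr M borel (e (0, t))) {K<..} = prob {\<omega>\<in>space M. K < e (0, t) \<omega>}" for t
      by (simp add: measure_distr vimage_def Int_def conj_commute)
    from this[of "int i - 1"] this[of 0] show ?thesis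
      using ident[of 0 "int i - 1"] by (simp add: D_def)
  qed
  have "{\<omega>\<in>space M. ?r {} \<omega> = 1} \<subseteq> {\<omega>\<in>space M. ?r UNIV \<omega> = 1} \<union> (\<Union>i\<in>{1..n}. D i)"
  proof
    fix \<omega> assume \<omega>: "\<omega> \<in> {\<omega>\<in>space M. ?r {} \<omega> = 1}"
    show "\<omega> \<in> {\<omega>\<in>space M. ?r UNIV \<omega> = 1} \<union> (\<Union>i\<in>{1..n}. D i)"
    proof (cases "\<omega> \<in> (\<Union>i\<in>{1..n}. D i)")
      case False
      then have "(\<lambda>i\<in>{1..n}. hybrid K {} (\<lambda>j. e j \<omega>) (int i)) = (\<lambda>i\<in>{1..n}. hybrid K UNIV (\<lambda>j. e j \<omega>) (int i))"
        using \<omega> by (intro restrict_ext) (auto simp: D_def hybrid_def)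
      with \<omega> show ?thesis by simp
    qed simp
  qed
  then have "emeasure M {\<omega>\<in>space M. ?r {} \<omega> = 1}
      \<le> emeasure M ({\<omega>\<in>space M. ?r UNIV \<omega> = 1} \<union> (\<Union>i\<in>{1..n}. D i))"
    using meas D by (intro emeasure_mono) auto
  also have "\<dots> \<le> emeasure M {\<omega>\<in>space M. ?r UNIV \<omega> = 1} + emeasure M (\<Union>i\<in>{1..n}. D i)"
    using meas D by (intro emeasure_subadditive) auto
  also have "\<dots> \<le> emeasure M {\<omega>\<in>space M. ?r UNIV \<omega> = 1} + (\<Sum>i\<in>{1..n}. emeasure M (D i))"
    using D by (intro add_left_mono emeasure_subadditive_finite) auto
  also have "(\<Sum>i\<in>{1..n}. emeasure M (D i)) = ennreal (real n * prob {\<omega>\<in>space M. K < e (0, 0) \<omega>})"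
    by (simp add: emeasure_eq_measure D_prob ennreal_mult ennreal_of_nat_eq_real_of_nat)
  finally show ?thesis unfolding rej .
qed

lemma tendsto_prob_noise_exceeds:
  "((\<lambda>K. prob {\<omega>\<in>space M. K < e (0, 0) \<omega>}) \<longlongrightarrow> 0) at_top"
proof -
  interpret D: real_distribution "distr M borel (e (0, 0))" by (rule real_distribution_distr) simp
  have "prob {\<omega>\<in>space M. K < e (0, 0) \<omega>} = 1 - cdf (distr M borel (e (0, 0))) K" for K
  proof -
    have "prob {\<omega>\<in>space M. K < e (0, 0) \<omega>} = measure (distr M borel (e (0, 0))) (- {..K})"
      by (subst measure_distr) (auto intro!: arg_cong[where f=prob])
    also have "\<dots> = 1 - cdf (distr M borel (e (0, 0))) K"
      using D.prob_compl[of "{..K}"] by (simp add: cdf_def Compl_eq_Diff_UNIV)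
    finally show ?thesis .
  qed
  with tendsto_diff[OF tendsto_const D.cdf_lim_at_top_prob, of 1] show ?thesis by simp
qed

section \<open>Conditional exceedance probabilities and means\<close>

text \<open>The side information only involves \<open>X\<close> strictly before time \<open>t\<close> and the other noises up to time \<open>t\<close>.\<close>

lemma real_cond_exp_law:
  assumes h[measurable]: "h \<in> borel_measurable path_space" and bounded: "\<And>w. \<bar>h w\<bar> \<le> 1"
    and \<phi>: "\<phi> \<in> borel_measurable (\<Pi>\<^sub>M j\<in>{(0, t), (1, t + 1)}. borel)"
    and h_\<phi>: "\<And>\<omega>. h (hybrid K UNIV (\<lambda>j. e j \<omega>)) = \<phi> (\<lambda>j\<in>{(0, t), (1, t + 1)}. e j \<omega>)"
  shows "AE w in law K UNIV. real_cond_exp (law K UNIV) (info_without_X (law K UNIV) t) h w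
      = (\<integral>w. h w \<partial>law K UNIV)"
proof -
  let ?T = "\<lambda>w. \<lambda>s\<in>{..t}. (Y_coord s w, Z_coord s w)"
  define B where "B = {0} \<times> {..<t} \<union> {1, 2 :: nat} \<times> {..t}"
  interpret L: prob_space "law K UNIV" by (rule prob_space_law)
  have T: "?T \<in> path_space \<rightarrow>\<^sub>M (\<Pi>\<^sub>M s\<in>{..t}. borel)"
    by (intro measurable_restrict) measurable
  have \<theta>: "(\<lambda>u. \<lambda>s\<in>{..t}. (fst (snd (hybrid K UNIV u s)), u (2, s)))
      \<in> (\<Pi>\<^sub>M j\<in>B. borel) \<rightarrow>\<^sub>M (\<Pi>\<^sub>M s\<in>{..t}. borel)"
  proof (rule measurable_restrict)
    fix s assume "s \<in> {..t}"
    \<comment> \<open>\<open>hybrid_component_measurable\<close> does not apply at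
      \<open>s = t\<close>: it asks for \<open>(0, t)\<close> in \<open>B\<close>, and exactly this
      noise must stay outside. Only the \<open>Y\<close> and \<open>Z\<close> components are read,
      which avoid it.\<close>
    then have [measurable]: "(\<lambda>u. u (0, s - 1)) \<in> borel_measurable (\<Pi>\<^sub>M j\<in>B. borel :: real measure)"
      "(\<lambda>u. u (1, s)) \<in> borel_measurable (\<Pi>\<^sub>M j\<in>B. borel :: real measure)"
      "(\<lambda>u. u (2, s)) \<in> borel_measurable (\<Pi>\<^sub>M j\<in>B. borel :: real measure)"
      "(\<lambda>u. u (2, s - 1)) \<in> borel_measurable (\<Pi>\<^sub>M j\<in>B. borel :: real measure)"
      by (auto intro!: measurable_component_singleton simp: B_def)
    show "(\<lambda>u. (fst (snd (hybrid K UNIV u s)), u (2, s))) \<in> (\<Pi>\<^sub>M j\<in>B. borel) \<rightarrow>\<^sub>M borel"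
      by (simp add: hybrid_def) measurable
  qed
  have "indep_pair M borel (\<lambda>\<omega>. \<phi> (\<lambda>j\<in>{(0, t), (1, t + 1)}. e j \<omega>)) (\<Pi>\<^sub>M s\<in>{..t}. borel)
      (\<lambda>\<omega>. \<lambda>s\<in>{..t}. (fst (snd (hybrid K UNIV (\<lambda>j\<in>B. e j \<omega>) s)), (\<lambda>j\<in>B. e j \<omega>) (2, s)))"
    by (rule indep_pair_noise[OF _ _ _ \<phi> \<theta>]) (auto simp: B_def)
  also have "(\<lambda>\<omega>. \<lambda>s\<in>{..t}. (fst (snd (hybrid K UNIV (\<lambda>j\<in>B. e j \<omega>) s)), (\<lambda>j\<in>B. e j \<omega>) (2, s)))
      = (\<lambda>\<omega>. ?T (hybrid K UNIV (\<lambda>j. e j \<omega>)))"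
    by (intro ext restrict_ext) (auto simp: B_def hybrid_def Y_coord_def Z_coord_def)
  finally have "indep_pair M borel (\<lambda>\<omega>. h (hybrid K UNIV (\<lambda>j. e j \<omega>))) (\<Pi>\<^sub>M s\<in>{..t}. borel)
      (\<lambda>\<omega>. ?T (hybrid K UNIV (\<lambda>j. e j \<omega>)))"
    unfolding h_\<phi> .
  then have "indep_pair (law K UNIV) borel h (\<Pi>\<^sub>M s\<in>{..t}. borel) ?T"
    unfolding law_def by (intro indep_pair_distr T) measurable
  moreover have "integrable (law K UNIV) h"
    by (rule L.integrable_const_bound[where B=1]) (use bounded in auto)
  ultimately show ?thesis
    unfolding info_without_X_def by (rule L.real_cond_exp_indep_vimage)
qed

lemma exceedance_prob_law:
  "AE w in law K UNIV. exceedance_prob (law K UNIV) t v w = prob {\<omega>\<in>space M. v < e (0, t) \<omega>}"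
proof -
  have "(\<integral>w. indicator {w. v < X_coord t w} w \<partial>law K UNIV) = prob {\<omega>\<in>space M. v < e (0, t) \<omega>}"
  proof -
    have "(\<integral>w. indicator {w. v < X_coord t w} w \<partial>law K UNIV)
        = (\<integral>\<omega>. indicator {w. v < X_coord t w} (hybrid K UNIV (\<lambda>j. e j \<omega>)) \<partial>M :: real)"
      unfolding law_def by (rule integral_distr) measurable
    also have "\<dots> = (\<integral>\<omega>. indicator {\<omega>\<in>space M. v < e (0, t) \<omega>} \<omega> \<partial>M)"
      by (intro Bochner_Integration.integral_cong) (auto simp: hybrid_def X_coord_def indicator_def)
    also have "\<dots> = prob {\<omega>\<in>space M. v < e (0, t) \<omega>}" by simp
    finally show ?thesis .
  qed
  moreover have "AE w in law K UNIV. real_cond_exp (law K UNIV) (info_without_X (law K UNIV) t)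
      (indicator {w. v < X_coord t w}) w = (\<integral>w. indicator {w. v < X_coord t w} w \<partial>law K UNIV)"
  proof (rule real_cond_exp_law[where \<phi>="\<lambda>u. indicator {v<..} (u (0, t))"])
    have [measurable]: "(\<lambda>u. u (0, t)) \<in> borel_measurable (\<Pi>\<^sub>M j\<in>{(0, t), (1, t + 1)}. borel :: real measure)"
      by (auto intro!: measurable_component_singleton)
    show "(\<lambda>u. indicator {v<..} (u (0, t)) :: real) \<in> borel_measurable (\<Pi>\<^sub>M j\<in>{(0, t), (1, t + 1)}. borel)"
      by measurable
  qed (auto simp: hybrid_def X_coord_def indicator_def)
  ultimately show ?thesis unfolding exceedance_prob_def by (simp only:)
qed

text \<open>For \<open>v\<close> at least \<open>K\<close> the function \<open>f\<close> drops out
  and the integrand involves two independent noises. One factor of its mean is the exceedance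
  probability, which cancels in the quotient; the other depends neither on \<open>v\<close> nor, by
  identical distribution, on \<open>t\<close>.\<close>

lemma numerator_law:
  fixes F :: "real \<Rightarrow> real"
  assumes F[measurable]: "F \<in> borel_measurable borel" and F_bounded: "\<And>y. \<bar>F y\<bar> \<le> 1" and v: "K \<le> v"
  shows "AE w in law K UNIV. real_cond_exp (law K UNIV) (info_without_X (law K UNIV) t)
        (\<lambda>w. F (Y_coord (t + 1) w) * indicator {w. v < X_coord t w} w) w
      = expectation (\<lambda>\<omega>. F (g (e (1, 0) \<omega>))) * prob {\<omega>\<in>space M. v < e (0, t) \<omega>}"
proof -
  let ?h = "\<lambda>w. F (Y_coord (t + 1) w) * indicator {w. v < X_coord t w} w"
  have "(\<integral>w. ?h w \<partial>law K UNIV) = (\<integral>\<omega>. F (g (e (1, t + 1) \<omega>)) * indicator {v<..} (e (0, t) \<omega>) \<partial>M)"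
    unfolding law_def using v
    by (subst integral_distr)
       (auto simp: hybrid_def X_coord_def Y_coord_def indicator_def intro!: Bochner_Integration.integral_cong)
  also have "\<dots> = expectation (\<lambda>\<omega>. F (g (e (1, t + 1) \<omega>))) * expectation (\<lambda>\<omega>. indicator {v<..} (e (0, t) \<omega>))"
  proof (rule indep_var_lebesgue_integral)
    have 1: "(\<lambda>u. F (g (u (1, t + 1)))) \<in> (\<Pi>\<^sub>M j\<in>{(1, t + 1)}. borel) \<rightarrow>\<^sub>M borel"
      by (rule measurable_component_compose) auto
    have 2: "(\<lambda>u. indicator {v<..} (u (0, t)) :: real) \<in> (\<Pi>\<^sub>M j\<in>{(0, t)}. borel) \<rightarrow>\<^sub>M borel"
      by (rule measurable_component_compose) auto
    show "indep_var borel (\<lambda>\<omega>. F (g (e (1, t + 1) \<omega>))) borel (\<lambda>\<omega>. indicator {v<..} (e (0, t) \<omega>) :: real)"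
      using indep_pair_noise[OF _ _ _ 1 2] by (simp add: indep_pair_iff_indep_var)
    show "integrable M (\<lambda>\<omega>. F (g (e (1, t + 1) \<omega>)))"
      by (rule integrable_const_bound[where B=1]) (use F_bounded in auto)
    show "integrable M (\<lambda>\<omega>. indicator {v<..} (e (0, t) \<omega>) :: real)"
      by (rule integrable_const_bound[where B=1]) (auto simp: indicator_def)
  qed
  also have "expectation (\<lambda>\<omega>. F (g (e (1, t + 1) \<omega>))) = expectation (\<lambda>\<omega>. F (g (e (1, 0) \<omega>)))"
  proof -
    have "expectation (\<lambda>\<omega>. F (g (e (1, s) \<omega>))) = (\<integral>x. F (g x) \<partial>distr M borel (e (1, s)))" for s
      by (subst integral_distr) auto
    then show ?thesis using ident[of 1 "t + 1"] by simp
  qed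
  also have "expectation (\<lambda>\<omega>. indicator {v<..} (e (0, t) \<omega>)) = prob {\<omega>\<in>space M. v < e (0, t) \<omega>}"
  proof -
    have "expectation (\<lambda>\<omega>. indicator {v<..} (e (0, t) \<omega>) :: real)
        = expectation (indicator {\<omega>\<in>space M. v < e (0, t) \<omega>})"
      by (intro Bochner_Integration.integral_cong) (auto simp: indicator_def)
    also have "\<dots> = prob {\<omega>\<in>space M. v < e (0, t) \<omega>}" by simp
    finally show ?thesis .
  qed
  finally have int: "(\<integral>w. ?h w \<partial>law K UNIV)
      = expectation (\<lambda>\<omega>. F (g (e (1, 0) \<omega>))) * prob {\<omega>\<in>space M. v < e (0, t) \<omega>}" .
  have "AE w in law K UNIV. real_cond_exp (law K UNIV) (info_without_X (law K UNIV) t) ?h w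
      = (\<integral>w. ?h w \<partial>law K UNIV)"
  proof (rule real_cond_exp_law[where \<phi>="\<lambda>u. F (g (u (1, t + 1))) * indicator {v<..} (u (0, t))"])
    have [measurable]: "(\<lambda>u. u (0, t)) \<in> borel_measurable (\<Pi>\<^sub>M j\<in>{(0, t), (1, t + 1)}. borel :: real measure)"
      "(\<lambda>u. u (1, t + 1)) \<in> borel_measurable (\<Pi>\<^sub>M j\<in>{(0, t), (1, t + 1)}. borel :: real measure)"
      by (auto intro!: measurable_component_singleton)
    show "(\<lambda>u. F (g (u (1, t + 1))) * indicator {v<..} (u (0, t)))
        \<in> borel_measurable (\<Pi>\<^sub>M j\<in>{(0, t), (1, t + 1)}. borel)"
      by measurable
  qed (use F_bounded v in \<open>auto simp: hybrid_def X_coord_def Y_coord_def indicator_def\<close>)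
  then show ?thesis unfolding int .
qed

section \<open>Support near infinity\<close>

text \<open>The ray beyond \<open>v\<close> is an open neighbourhood of the support point
  \<open>max a v + 1\<close>. Positivity is needed twice: for the denominators of the conditional
  means, and to give the switch a positive probability.\<close>

lemma noise_exceeds_pos:
  assumes "supported_near_infinity (law K {})"
  shows "prob {\<omega>\<in>space M. v < e (0, t) \<omega>} > 0"
proof -
  obtain a where a: "{a<..} \<subseteq> law_support (distr (law K {}) borel (X_coord t))"
    using assms unfolding supported_near_infinity_def by blast
  have "max a v + 1 \<in> {a<..}" by auto
  with a have "\<forall>U. open U \<and> max a v + 1 \<in> U \<longrightarrow> emeasure (distr (law K {}) borel (X_coord t)) U > 0"
    unfolding law_support_def by blast
  then have "emeasure (distr (law K {}) borel (X_coord t)) {v<..} > 0" by auto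
  also have "emeasure (distr (law K {}) borel (X_coord t)) {v<..} = emeasure M {\<omega>\<in>space M. v < e (0, t) \<omega>}"
    unfolding law_def by (simp add: distr_distr emeasure_distr comp_def X_coord_def hybrid_def vimage_def Int_def conj_commute)
  finally show ?thesis by (simp add: emeasure_eq_measure)
qed

text \<open>\<open>X\<close> and \<open>Z\<close> are untouched. For \<open>Y\<close> the switched
  values alone suffice: the switching event has positive probability and is independent of an
  exponential value charging every open set that meets the positive half-line.\<close>

lemma supported_near_infinity_law:
  assumes supp: "supported_near_infinity (law K {})"
  shows "supported_near_infinity (law K UNIV)"
  unfolding supported_near_infinity_def
proof (intro allI ballI)
  fix t V assume "V \<in> {X_coord t, Y_coord t, Z_coord t}"
  then consider "V = X_coord t" | "V = Z_coord t" | "V = Y_coord t" by auto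
  then show "\<exists>a. {a<..} \<subseteq> law_support (distr (law K UNIV) borel V)"
  proof cases
    case 1
    have "distr (law K UNIV) borel (X_coord t) = distr (law K {}) borel (X_coord t)"
      unfolding law_def by (simp add: distr_distr comp_def X_coord_def hybrid_def)
    with supp 1 show ?thesis unfolding supported_near_infinity_def by simp
  next
    case 2
    have "distr (law K UNIV) borel (Z_coord t) = distr (law K {}) borel (Z_coord t)"
      unfolding law_def by (simp add: distr_distr comp_def Z_coord_def hybrid_def)
    with supp 2 show ?thesis unfolding supported_near_infinity_def by simp
  next
    case 3
    have "x \<in> law_support (distr (law K UNIV) borel (Y_coord t))" if x: "0 < x" for x
      unfolding law_support_def
    proof safe
      fix U :: "real set" assume U: "open U" "x \<in> U"
      then have [measurable]: "U \<in> sets borel" by simp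
      have 1: "(\<lambda>u. u (0, t - 1)) \<in> (\<Pi>\<^sub>M j\<in>{(0, t - 1)}. borel) \<rightarrow>\<^sub>M (borel :: real measure)"
        by (rule measurable_component_singleton) simp
      have 2: "(\<lambda>u. g (u (1, t))) \<in> (\<Pi>\<^sub>M j\<in>{(1, t)}. borel) \<rightarrow>\<^sub>M borel"
        by (rule measurable_component_compose) simp_all
      have "indep_pair M borel (e (0, t - 1)) borel (\<lambda>\<omega>. g (e (1, t) \<omega>))"
        using indep_pair_noise[OF _ _ _ 1 2] by simp
      from indep_pair_prob[OF this, of "{K<..}" U]
      have "prob {\<omega>\<in>space M. K < e (0, t - 1) \<omega> \<and> g (e (1, t) \<omega>) \<in> U}
          = prob {\<omega>\<in>space M. K < e (0, t - 1) \<omega>} * prob {\<omega>\<in>space M. g (e (1, t) \<omega>) \<in> U}"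
        by simp
      also have "\<dots> > 0"
        using noise_exceeds_pos[OF supp] distributed_exponential_open_pos[OF g_distributed _ U x] by simp
      finally have "0 < emeasure M {\<omega>\<in>space M. K < e (0, t - 1) \<omega> \<and> g (e (1, t) \<omega>) \<in> U}"
        by (simp add: emeasure_eq_measure)
      also have "\<dots> \<le> emeasure M ((\<lambda>\<omega>. Y_coord t (hybrid K UNIV (\<lambda>j. e j \<omega>))) -` U \<inter> space M)"
        by (intro emeasure_mono) (auto simp: Y_coord_def hybrid_def intro!: measurable_sets_borel)
      also have "\<dots> = emeasure (distr (law K UNIV) borel (Y_coord t)) U"
        unfolding law_def by (simp add: distr_distr emeasure_distr comp_def)
      finally show "0 < emeasure (distr (law K UNIV) borel (Y_coord t)) U" .
    qed
    then have "{0<..} \<subseteq> law_support (distr (law K UNIV) borel (Y_coord t))" by auto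
    with 3 show ?thesis by blast
  qed
qed

section \<open>The extremal limit under the modified law\<close>

text \<open>Rational thresholds are countable, so one null set covers them all. From the first
  chosen rational above \<open>K\<close> onwards the quotient is constant, so the limit is
  attained.\<close>

lemma AE_law_exceedance:
  fixes F :: "real \<Rightarrow> real"
  assumes supp: "supported_near_infinity (law K {})"
    and F: "F \<in> borel_measurable borel" "\<And>y. \<bar>F y\<bar> \<le> 1"
  shows "AE w in law K UNIV. (\<forall>q::rat. exceedance_prob (law K UNIV) t (of_rat q) w > 0) \<and>
    ((\<lambda>q::rat. exceedance_mean F (law K UNIV) t (of_rat q) w) \<longlongrightarrow> expectation (\<lambda>\<omega>. F (g (e (1, 0) \<omega>)))) at_top"
proof -
  let ?p = "\<lambda>q::rat. prob {\<omega>\<in>space M. of_rat q < e (0, t) \<omega>}"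
  let ?c = "expectation (\<lambda>\<omega>. F (g (e (1, 0) \<omega>)))"
  have p: "?p q > 0" for q using supp by (rule noise_exceeds_pos)
  have "AE w in law K UNIV. \<forall>q::rat. exceedance_prob (law K UNIV) t (of_rat q) w = ?p q"
    unfolding AE_all_countable by (intro allI exceedance_prob_law)
  moreover have "AE w in law K UNIV. \<forall>q::rat. K \<le> of_rat q \<longrightarrow>
      real_cond_exp (law K UNIV) (info_without_X (law K UNIV) t)
        (\<lambda>w. F (Y_coord (t + 1) w) * indicator {w. of_rat q < X_coord t w} w) w = ?c * ?p q"
    unfolding AE_all_countable
  proof
    fix q :: rat
    show "AE w in law K UNIV. K \<le> of_rat q \<longrightarrow>
      real_cond_exp (law K UNIV) (info_without_X (law K UNIV) t)
        (\<lambda>w. F (Y_coord (t + 1) w) * indicator {w. of_rat q < X_coord t w} w) w = ?c * ?p q"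
      using numerator_law[OF F, of K "of_rat q" t] by (cases "K \<le> of_rat q") auto
  qed
  ultimately show ?thesis
  proof eventually_elim
    case (elim w)
    obtain q0 :: rat where q0: "K < of_rat q0"
      using of_rat_dense[of K "K + 1"] by auto
    have "exceedance_mean F (law K UNIV) t (of_rat q) w = ?c" if "q0 \<le> q" for q
    proof -
      have "K \<le> of_rat q" using q0 that by (meson less_imp_le of_rat_less_eq order_trans)
      then show ?thesis using elim p[of q] unfolding exceedance_mean_def by simp
    qed
    then have "\<forall>\<^sub>F q in at_top. exceedance_mean F (law K UNIV) t (of_rat q) w = ?c"
      by (auto simp: eventually_at_top_linorder)
    then have "((\<lambda>q::rat. exceedance_mean F (law K UNIV) t (of_rat q) w) \<longlongrightarrow> ?c) at_top"
      by (rule tendsto_eventually)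
    with elim p show ?case by simp
  qed
qed

lemma extremally_regular_law:
  fixes F :: "real \<Rightarrow> real"
  assumes supp: "supported_near_infinity (law K {})"
    and F: "F \<in> borel_measurable borel" "\<And>y. 0 \<le> F y" "\<And>y. F y < 1"
  shows "extremally_regular F (law K UNIV)" "AE w in law K UNIV. Gamma F (law K UNIV) t w < 1"
proof -
  have F1: "\<bar>F y\<bar> \<le> 1" for y using F(2,3)[of y] by (simp add: less_imp_le)
  note lim = AE_law_exceedance[OF supp F(1) F1]
  have "Gamma_exists F (law K UNIV)"
    unfolding Gamma_exists_def
  proof
    fix t show "AE w in law K UNIV. (\<forall>q::rat. 0 < exceedance_prob (law K UNIV) t (of_rat q) w) \<and>
        (\<exists>l. ((\<lambda>q::rat. exceedance_mean F (law K UNIV) t (of_rat q) w) \<longlongrightarrow> l) at_top)"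
      using lim[of t] by eventually_elim blast
  qed
  with supported_near_infinity_law[OF supp] show "extremally_regular F (law K UNIV)"
    by (simp add: extremally_regular_def)
  have [measurable]: "F \<in> borel_measurable borel" by fact
  \<comment> \<open>A function that is below 1 at every point has mean strictly below 1 under a
    probability measure; this is where \<open>F y < 1\<close> for all \<open>y\<close>
    enters.\<close>
  have c: "expectation (\<lambda>\<omega>. F (g (e (1, 0) \<omega>))) < 1"
    by (rule expectation_less) (use F F1 in \<open>auto intro!: integrable_const_bound[where B=1]\<close>)
  show "AE w in law K UNIV. Gamma F (law K UNIV) t w < 1"
    using lim[of t]
  proof eventually_elim
    case (elim w)
    then have "Gamma F (law K UNIV) t w = expectation (\<lambda>\<omega>. F (g (e (1, 0) \<omega>)))"
      unfolding Gamma_def by (intro tendsto_Lim) auto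
    with c show ?case by simp
  qed
qed

end

section \<open>From laws in \<open>A0\<close> to the conclusion\<close>

text \<open>Since the \<open>Y\<close>-noise has the same law at all times, the transform built from
  \<open>eY 0\<close> yields an exponential value at every time.\<close>

lemma innovation_model_cdf_transform:
  assumes "prob_space M"
    and iid: "iid_continuous M eX" "iid_continuous M eY" "iid_continuous M eZ"
    and indep: "sequences_mutually_indep M eX eY eZ"
    and f: "f \<in> borel_measurable borel"
  shows "innovation_model M (\<lambda>(i, t). ([eX, eY, eZ] ! i) t) f (\<lambda>y. - ln (1 - cdf (distr M borel (eY 0)) y))"
proof -
  interpret prob_space M by fact
  define s where "s i = [eX, eY, eZ] ! i" for i
  have s: "iid_continuous M (s i)" if "i \<in> {0, 1, 2}" for i
    using that iid by (auto simp: s_def)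
  have cont: "continuous_on UNIV (cdf (distr M borel (eY 0)))"
    using iid by (simp add: iid_continuous_def)
  show ?thesis
  proof
    have "indep_vars (\<lambda>(i, t). borel) (\<lambda>(i, t). s i t) ({0, 1, 2} \<times> UNIV)"
    proof (rule indep_vars_nested)
      show "indep_vars (\<lambda>i. \<Pi>\<^sub>M t\<in>UNIV. borel) (\<lambda>i \<omega>. \<lambda>t\<in>UNIV. s i t \<omega>) {0, 1, 2}"
        using indep unfolding sequences_mutually_indep_def s_def restrict_UNIV .
      show "indep_vars (\<lambda>_. borel) (s i) UNIV" if "i \<in> {0, 1, 2}" for i
        using s[OF that] by (simp add: iid_continuous_def)
    qed
    then show "indep_vars (\<lambda>_. borel) (\<lambda>(i, t). ([eX, eY, eZ] ! i) t) noise_index"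
      by (simp add: s_def case_prod_unfold)
  next
    fix i :: nat and t assume "i \<in> {0, 1, 2}"
    from s[OF this] show "distr M borel (case (i, t) of (i, t) \<Rightarrow> ([eX, eY, eZ] ! i) t)
        = distr M borel (case (i, 0) of (i, t) \<Rightarrow> ([eX, eY, eZ] ! i) t)"
      by (simp add: iid_continuous_def s_def)
  next
    show "f \<in> borel_measurable borel" by fact
    have [measurable]: "cdf (distr M borel (eY 0)) \<in> borel_measurable borel"
      using cont by (rule borel_measurable_continuous_onI)
    show "(\<lambda>y. - ln (1 - cdf (distr M borel (eY 0)) y)) \<in> borel_measurable borel" by measurable
  next
    fix t
    have rv: "random_variable borel (eY t)" and eq: "distr M borel (eY t) = distr M borel (eY 0)"
      using iid(2) by (auto simp: iid_continuous_def indep_vars_def2)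
    show "distributed M lborel (\<lambda>\<omega>. - ln (1 - cdf (distr M borel (eY 0)) ((case (1, t) of (i, t) \<Rightarrow> ([eX, eY, eZ] ! i) t) \<omega>)))
        (\<lambda>x. ennreal (exponential_density 1 x))"
      using exponential_distributed_cdf_transform[OF rv] cont by (simp add: eq)
  qed
qed

theorem corollary1:
  fixes n :: nat and \<alpha> :: real and \<mu> :: "real measure"
    and \<psi> :: "(nat \<Rightarrow> real \<times> real \<times> real) \<Rightarrow> nat" and P :: "path measure"
  assumes "real_distribution \<mu>" and "\<And>x. cdf \<mu> x < 1"
    and "0 < \<alpha>" and "\<alpha> < 1"
    and "\<psi> \<in> (\<Pi>\<^sub>M i\<in>{1..n}. borel) \<rightarrow>\<^sub>M count_space {0, 1}"
    and "P \<in> A0" and "extremally_regular (cdf \<mu>) P"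
    and "(SUP Q \<in> P0_ext (cdf \<mu>). rejection_prob n \<psi> Q) \<le> ennreal \<alpha>"
  shows "rejection_prob n \<psi> P \<le> ennreal \<alpha>"
proof -
  from \<open>P \<in> A0\<close> obtain M :: "sample measure" and X Y Z eX eY eZ f where
    M: "prob_space M" and XYZ: "real_process M X" "real_process M Y" "real_process M Z"
    and e: "iid_continuous M eX" "iid_continuous M eY" "iid_continuous M eZ"
      "sequences_mutually_indep M eX eY eZ" "f \<in> borel_measurable borel"
    and eqs: "\<And>t. AE \<omega> in M. Z t \<omega> = eZ t \<omega> \<and> X t \<omega> = eX t \<omega> \<and> Y t \<omega> = f (X (t - 1) \<omega>, Z (t - 1) \<omega>, eY t \<omega>)"
    and P: "P = process_law M X Y Z"
    unfolding A0_def by blast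
  interpret prob_space M by fact
  define g where "g = (\<lambda>y. - ln (1 - cdf (distr M borel (eY 0)) y))"
  define noise where "noise = (\<lambda>(i, t). ([eX, eY, eZ] ! i) t)"
  interpret innovation_model M noise f g
    unfolding noise_def g_def by (intro innovation_model_cdf_transform M e)
  have law_empty: "law K {} = P" for K
  proof -
    \<comment> \<open>The structural equations hold almost surely at each time separately. Time is
      countable, so almost every path satisfies all of them and equals the unswitched
      \<open>hybrid\<close>, whatever \<open>K\<close> is.\<close>
    have "AE \<omega> in M. \<forall>t. Z t \<omega> = eZ t \<omega> \<and> X t \<omega> = eX t \<omega> \<and> Y t \<omega> = f (X (t - 1) \<omega>, Z (t - 1) \<omega>, eY t \<omega>)"
      unfolding AE_all_countable using eqs by blast
    then have "AE \<omega> in M. hybrid K {} (\<lambda>j. noise j \<omega>) = (\<lambda>t. (X t \<omega>, Y t \<omega>, Z t \<omega>))"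
      by eventually_elim (simp add: hybrid_def noise_def fun_eq_iff numeral_2_eq_2)
    moreover have "(\<lambda>\<omega> t. (X t \<omega>, Y t \<omega>, Z t \<omega>)) \<in> M \<rightarrow>\<^sub>M path_space"
    proof -
      have [measurable]: "X t \<in> borel_measurable M" "Y t \<in> borel_measurable M" "Z t \<in> borel_measurable M" for t
        using XYZ by (auto simp: real_process_def)
      show ?thesis unfolding path_space_def by (rule measurable_abs_UNIV) measurable
    qed
    ultimately show ?thesis
      unfolding P law_def process_law_def by (intro distr_cong_AE) simp_all
  qed
  have supp: "supported_near_infinity (law K {})" and ac: "fdd_absolutely_continuous (law K {})" for K
    using \<open>P \<in> A0\<close> \<open>extremally_regular (cdf \<mu>) P\<close>
    by (simp_all add: law_empty A0_def Xi0_def extremally_regular_def)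
  interpret \<mu>: real_distribution \<mu> by fact
  have F: "cdf \<mu> \<in> borel_measurable borel"
    by (rule borel_measurable_mono) (simp add: mono_def \<mu>.cdf_nondecreasing)
  have member: "law K UNIV \<in> P0_ext (cdf \<mu>)" for K
  proof -
    let ?Y = "\<lambda>t \<omega>. fst (snd (hybrid K UNIV (\<lambda>j. noise j \<omega>) t))"
    have "real_process M (\<lambda>t. noise (0, t))" "real_process M ?Y" "real_process M (\<lambda>t. noise (2, t))"
      unfolding real_process_def by measurable
    then have "law K UNIV \<in> Xi0"
      unfolding Xi0_def
      using M strictly_stationary_law fdd_absolutely_continuous_law[OF ac] nonlinear_Y_recursion_hybrid
        process_law_hybrid[symmetric] by blast
    then show ?thesis
      unfolding P0_ext_def
      using extremally_regular_law[OF supp F \<mu>.cdf_nonneg assms(2)] by blast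
  qed
  have bound: "rejection_prob n \<psi> P \<le> ennreal (\<alpha> + real n * prob {\<omega>\<in>space M. K < noise (0, 0) \<omega>})" for K
  proof -
    have "rejection_prob n \<psi> P
        \<le> rejection_prob n \<psi> (law K UNIV) + ennreal (real n * prob {\<omega>\<in>space M. K < noise (0, 0) \<omega>})"
      using rejection_prob_law_le[OF assms(5)] by (simp only: law_empty)
    also have "rejection_prob n \<psi> (law K UNIV) \<le> ennreal \<alpha>"
      using SUP_upper[OF member] assms(8) by (rule order_trans)
    finally show ?thesis using \<open>0 < \<alpha>\<close> by (simp add: ennreal_plus add_right_mono)
  qed
  \<comment> \<open>Exceedances of \<open>K\<close> keep positive probability however large
    \<open>K\<close> is, so for positive \<open>n\<close> no single modified law gives the bound
    \<open>\<alpha>\<close>. As \<open>P\<close> and the test do not depend on \<open>K\<close>, the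
    excess vanishes in the limit.\<close>
  have "((\<lambda>K. ennreal (\<alpha> + real n * prob {\<omega>\<in>space M. K < noise (0, 0) \<omega>})) \<longlongrightarrow> ennreal (\<alpha> + real n * 0)) at_top"
    by (intro tendsto_intros tendsto_prob_noise_exceeds)
  from tendsto_lowerbound[OF this] bound show ?thesis by simp
qed

end
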